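(* Let $N$ agents $\mathcal V=\{1,\dots,N\}$, a feasible set $\Omega\subseteq\mathbb R^n$, local cost functions $f_i:\mathbb R^n\to\mathbb R$ ($i\in\mathcal V$), and a digraph $\mathcal G$ on $\mathcal V$ with adjacency matrix $[a_{ij}]\in\mathbb R^{N\times N}$ be given such that: (a) $\Omega$ is convex, compact and nonempty; (b) each $f_i$ is convex and differentiable, and $\nabla f_i$ is $\kappa$-Lipschitz on $\Omega$ for a constant $\kappa>0$; (c) $\mathcal G$ is strongly connected and weight-balanced. Consider the optimization problem $$\min_{x\in\mathbb R^n}F(x)\quad\text{s.t. } x\in\Omega,\qquad F(x)=\frac1N\sum_{i=1}^N f_i(x).$$ Let $\beta(t)$ be a positive time-varying parameter with $\lim_{t\to\infty}\beta(t)=0$ and $\lim_{t\to\infty}\int_0^t\beta(\tau)\,d\tau=\infty$, and let $x_i(t),y_i(t),z_i(t),v_i(t)\in\mathbb R^n$, $i\in\mathcal V$, $t\ge 0$, evolve according to $$\dot x_i(t)=\sum_{j=1}^N a_{ij}(x_j(t)-x_i(t))+\beta(t)(v_i(t)-x_i(t)),\qquad v_i(t)\in\arg\min_{v\in\Omega} z_i(t)^{T}v,$$ $$\dot y_i(t)=\sum_{j=1}^N a_{ij}(z_j(t)-z_i(t)),\qquad z_i(t)=y_i(t)+\nabla f_i(x_i(t)),$$ with initial condition $x_i(0)\in\Omega$, $y_i(0)=\mathbf 0_n$, $z_i(0)\in\mathbb R^n$, $v_i(0)\in\Omega$ for all $i\in\mathcal V$. Then: (i) all decision variables $x_i$ achieve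 consensus, i.e. $\lim_{t\to\infty}(x_i(t)-x_j(t))=\mathbf 0_n$ for all $i,j\in\mathcal V$; (ii) all variables $z_i$ asymptotically track the dynamical global gradient, i.e. $\lim_{t\to\infty}\big(z_i(t)-\frac1N\sum_{j=1}^N\nabla f_j(x_j(t))\big)=\mathbf 0_n$ for all $i\in\mathcal V$; (iii) all decision variables $x_i$, $i\in\mathcal V$, converge to a consensual (i.e. common) optimal solution of the optimization problem.
   Context: The digraph $\mathcal G=(\mathcal V,\mathcal E)$, $\mathcal E\subseteq\mathcal V\times\mathcal V$, has adjacency matrix $[a_{ij}]$ with $a_{ij}>0$ if and only if $(i,j)\in\mathcal E$ (agent $j$ can send information to agent $i$), and $a_{ij}=0$ otherwise. $\mathcal G$ is strongly connected if there is a directed path between any pair of vertices (in each direction), and weight-balanced if $\sum_{j=1}^N a_{ij}=\sum_{j=1}^N a_{ji}$ for all $i\in\mathcal V$. $\nabla f$ is $\kappa$-Lipschitz on a convex set $C$ if $\|\nabla f(x)-\nabla f(y)\|\le\kappa\|x-y\|$ for all $x,y\in C$, with $\|\cdot\|$ the Euclidean norm. $\mathbf 0_n$ is the zero vector of $\mathbb R^n$.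
   Formalization: In (iii), the x_i are shown to approach one common, possibly moving, optimal solution p(t), and a fixed point only if the optimal solution is unique; convergence to a fixed point fails in general, e.g. for constant costs with an oscillating choice of v_i. *)

theory Defs
  imports "HOL-Analysis.Analysis"
begin

definition gradient :: "('a::euclidean_space \<Rightarrow> real) \<Rightarrow> 'a \<Rightarrow> 'a" where
  "gradient f x = (THE D. GDERIV f x :> D)"

lemma gradient_eqI:
  assumes "GDERIV f x :> D"
  shows "gradient f x = D"
  unfolding gradient_def
proof (rule the_equality)
  show "GDERIV f x :> D" by fact
next
  fix D' assume "GDERIV f x :> D'"
  with assms have "(\<lambda>h. inner h D') = (\<lambda>h. inner h D)"
    unfolding gderiv_def by (rule has_derivative_unique[rotated])
  then have "inner h D' = inner h D" for h by meson
  then show "D' = D" by (metis inner_commute vector_eq_rdot)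
qed

lemma GDERIV_gradient:
  assumes "f differentiable (at x)"
  shows "GDERIV f x :> gradient f x"
proof -
  obtain f' where f': "(f has_derivative f') (at x)"
    using assms unfolding differentiable_def by blast
  interpret bounded_linear f' using f' by (rule has_derivative_bounded_linear)
  define D where "D = (\<Sum>b\<in>Basis. f' b *\<^sub>R b)"
  have "f' h = inner h D" for h
  proof -
    have "f' h = f' (\<Sum>b\<in>Basis. inner h b *\<^sub>R b)" by (simp add: euclidean_representation)
    also have "\<dots> = inner h D"
      by (simp add: sum scaleR D_def inner_sum_right mult.commute)
    finally show ?thesis .
  qed
  then have "GDERIV f x :> D" using f' unfolding gderiv_def by presburger
  with gradient_eqI[OF this] show ?thesis by simp
qed

text \<open>
  \<^term>\<open>A $ i $ j\<close> is the weight with which agent \<open>i\<close> uses the information received from agent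
  \<open>j\<close>, and it is positive exactly when \<open>(i, j)\<close> is an edge. Self-loops are not excluded.
\<close>

definition adjacency_matrix :: "('v \<times> 'v) set \<Rightarrow> real^'v^'v \<Rightarrow> bool" where
  "adjacency_matrix E A \<longleftrightarrow>
     (\<forall>i j. ((i, j) \<in> E \<longrightarrow> A $ i $ j > 0) \<and> ((i, j) \<notin> E \<longrightarrow> A $ i $ j = 0))"

definition strongly_connected :: "('v \<times> 'v) set \<Rightarrow> bool" where
  "strongly_connected E \<longleftrightarrow> (\<forall>i j. (i, j) \<in> E\<^sup>*)"

definition weight_balanced :: "real^'v^'v \<Rightarrow> bool" where
  "weight_balanced A \<longleftrightarrow> (\<forall>i. (\<Sum>j\<in>UNIV. A $ i $ j) = (\<Sum>j\<in>UNIV. A $ j $ i))"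

text \<open>
  \<open>u' = w\<close> on \<open>[0, \<infinity>)\<close> in integrated form. A minimiser chosen from a set that
  varies with time need not depend continuously on time, so a right-hand side containing it is in
  general only measurable, and \<open>u\<close> is then not differentiable at every time. Since the integral is
  the Henstock-Kurzweil integral, this covers both the Caratheodory solutions (\<open>u\<close> locally
  absolutely continuous, \<open>u' = w\<close> almost everywhere) and the everywhere differentiable ones
  (lemma below).
\<close>

definition solves_ode_integrated :: "(real \<Rightarrow> 'a::euclidean_space) \<Rightarrow> (real \<Rightarrow> 'a) \<Rightarrow> bool" where
  "solves_ode_integrated u w \<longleftrightarrow> (\<forall>t\<ge>0. (w has_integral (u t - u 0)) {0..t})"

lemma solves_ode_integrated_if_has_vector_derivative:
  assumes "\<And>t. t \<ge> 0 \<Longrightarrow> (u has_vector_derivative w t) (at t within {0..})"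
  shows "solves_ode_integrated u w"
  unfolding solves_ode_integrated_def
proof (intro allI impI)
  fix t :: real assume "t \<ge> 0"
  then show "(w has_integral (u t - u 0)) {0..t}"
    by (intro fundamental_theorem_of_calculus)
       (auto intro: has_vector_derivative_within_subset[OF assms])
qed

definition global_cost :: "('v::finite \<Rightarrow> 'a \<Rightarrow> real) \<Rightarrow> 'a \<Rightarrow> real" where
  "global_cost f p = 1 / real CARD('v) * (\<Sum>i\<in>UNIV. f i p)"

definition optimal_solutions :: "('v::finite \<Rightarrow> 'a \<Rightarrow> real) \<Rightarrow> 'a set \<Rightarrow> 'a set" where
  "optimal_solutions f \<Omega> = {p. is_arg_min (global_cost f) (\<lambda>q. q \<in> \<Omega>) p}"

text \<open>
  The minimiser need not be unique, and then single trajectories can drift forever inside the set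
  of optimal solutions (for instance if all costs are constant, every choice of the Frank-Wolfe
  direction is admissible). Convergence to a common optimal solution therefore means that all
  agents approach one and the same moving optimal solution, which is a fixed point as soon as the
  minimiser is unique.
\<close>

definition converge_to_common_optimum ::
    "('v::finite \<Rightarrow> 'a::euclidean_space \<Rightarrow> real) \<Rightarrow> 'a set \<Rightarrow> ('v \<Rightarrow> real \<Rightarrow> 'a) \<Rightarrow> bool" where
  "converge_to_common_optimum f \<Omega> x \<longleftrightarrow>
     (\<exists>p. (\<forall>t. p t \<in> optimal_solutions f \<Omega>) \<and> (\<forall>i. ((\<lambda>t. x i t - p t) \<longlongrightarrow> 0) at_top))"

end

theory Submission
  imports Defs
begin

text \<open>
  Weight balance makes the Laplacian flow preserve averages, and together with strong connectivity
  it makes the flow dissipate disagreement: the inner product of the disagreement with the flow is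
  at most \<open>- \<mu>\<close> times the squared norm of the disagreement (\<open>disagreement_dissipation\<close>).
  Both \<open>x\<close> and \<open>z\<close> are driven by this flow and by a perturbation \<open>R\<close> that becomes slow,
  \<open>norm (R b - R a) \<le> \<epsilon> * (b - a)\<close> for late times, so that the dissipation wins and the
  disagreement dies out (\<open>perturbed_consensus\<close>).

  For \<open>x\<close>, the perturbation is the integral of \<open>\<beta> (v - x)\<close>. It is slow because \<open>\<beta> \<rightarrow> 0\<close> and
  because \<open>x\<close> never leaves the bounded set \<open>\<Omega>\<close>: the total squared distance of the agents to
  \<open>\<Omega>\<close> starts at zero and cannot grow (\<open>feasible_set_invariant\<close>). This is consensus.
  For \<open>z = y + \<nabla>f(x)\<close>, the perturbation is the vector of local gradients. It is slow
  because the gradients are Lipschitz and, after consensus, \<open>x\<close> itself moves slowly. The average of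
  the \<open>y\<^sub>i\<close> stays zero, so the common value tracked by the \<open>z\<^sub>i\<close> is the average gradient.

  The average \<open>c\<close> of the \<open>x\<^sub>i\<close> then runs a centralised Frank-Wolfe flow
  \<open>c' = \<beta> (d - c)\<close> whose direction \<open>d\<close> minimises the linearisation of \<open>F\<close> at \<open>c\<close> over \<open>\<Omega>\<close> up to an
  error that vanishes. By convexity the optimality gap decreases at rate at least
  \<open>\<beta> r / 2\<close> as long as it exceeds \<open>r\<close>, and the integral of \<open>\<beta>\<close> diverges, so
  the gap tends to zero (\<open>frank_wolfe_optimality\<close>). On a compact set a vanishing gap forces
  the distance to the set of minimisers to vanish (\<open>infdist_minimizers_tendsto_0\<close>).

  The trajectories satisfy their equations only in integrated form, so a Lyapunov function cannot
  be differentiated along them. Instead its increments over short intervals are estimated and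
  added up (\<open>descent_along_curve\<close>); all that is asked of the function is a quadratic upper
  bound around each point.
\<close>

section \<open>Descent along curves without derivatives\<close>

text \<open>
  Cut \<open>[s, t]\<close> into pieces shorter than \<open>\<delta>\<close>: both sides telescope, which leaves
  \<open>\<eta> * (W t - W s)\<close> for arbitrary \<open>\<eta>\<close>. This replaces the argument that a function
  with nonpositive derivative decreases.
\<close>

lemma le_if_locally_almost_le:
  fixes g W :: "real \<Rightarrow> real"
  assumes "s \<le> t"
    and local: "\<And>\<eta>. \<eta> > 0 \<Longrightarrow> \<exists>\<delta>>0. \<forall>a b. s \<le> a \<longrightarrow> a \<le> b \<longrightarrow> b \<le> t \<longrightarrow> b - a < \<delta> \<longrightarrow>
                  g b - g a \<le> \<eta> * (W b - W a)"
  shows "g t \<le> g s"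
proof -
  have global: "g t - g s \<le> \<eta> * (W t - W s)" if \<eta>: "\<eta> > 0" for \<eta>
  proof -
    obtain \<delta> where \<delta>: "\<delta> > 0" and step: "\<And>a b. s \<le> a \<Longrightarrow> a \<le> b \<Longrightarrow> b \<le> t \<Longrightarrow> b - a < \<delta> \<Longrightarrow>
                  g b - g a \<le> \<eta> * (W b - W a)"
      using local[OF \<eta>] by blast
    obtain n :: nat where n: "(t - s) / \<delta> < real n"
      using reals_Archimedean2 by blast
    have "0 \<le> (t - s) / \<delta>" using \<open>s \<le> t\<close> \<delta> by simp
    with n have n0: "real n > 0" by linarith
    define p where "p k = s + real k * ((t - s) / n)" for k
    have mesh: "(t - s) / n < \<delta>" "0 \<le> (t - s) / n"
      using n n0 \<delta> \<open>s \<le> t\<close> by (auto simp: field_simps)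
    have ends: "p 0 = s" "p n = t" using n0 by (auto simp: p_def)
    have sum_step: "g (p (Suc k)) - g (p k) \<le> \<eta> * (W (p (Suc k)) - W (p k))" if "k < n" for k
    proof (rule step)
      show "s \<le> p k" using mult_nonneg_nonneg[OF of_nat_0_le_iff mesh(2)] by (simp add: p_def)
      have d: "p (Suc k) - p k = (t - s) / n" unfolding p_def of_nat_Suc by (simp only: algebra_simps)
      show "p k \<le> p (Suc k)" "p (Suc k) - p k < \<delta>" using d mesh by linarith+
      have "real (Suc k) * ((t - s) / n) \<le> real n * ((t - s) / n)"
        using that mesh by (intro mult_right_mono) auto
      then show "p (Suc k) \<le> t" using n0 by (simp add: p_def)
    qed
    have "g t - g s = (\<Sum>k<n. g (p (Suc k)) - g (p k))"
      using sum_lessThan_telescope[of "\<lambda>k. g (p k)" n] ends by simp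
    also have "\<dots> \<le> (\<Sum>k<n. \<eta> * (W (p (Suc k)) - W (p k)))"
      by (intro sum_mono sum_step) simp
    also have "\<dots> = \<eta> * (W t - W s)"
      using sum_lessThan_telescope[of "\<lambda>k. W (p k)" n] ends
      by (simp flip: sum_distrib_left)
    finally show ?thesis .
  qed
  show ?thesis
  proof (rule field_le_epsilon)
    fix e :: real assume e: "e > 0"
    define c where "c = \<bar>W t - W s\<bar> + 1"
    have c: "c > 0" by (simp add: c_def)
    have "g t - g s \<le> e / c * (W t - W s)" using global[of "e / c"] e c by simp
    also have "\<dots> \<le> e / c * c" using e c by (intro mult_left_mono) (auto simp: c_def)
    finally show "g t \<le> g s + e" using c by simp
  qed
qed

text \<open>
  \<open>W\<close> bounds the length of the curve and the increments of \<open>M\<close> are the intended decrease of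
  \<open>\<phi>\<close>. The quadratic term of
  the upper bound is at most \<open>C * (W b - W a)\<^sup>2\<close>, which is negligible against
  \<open>W b - W a\<close> because \<open>W\<close> is uniformly continuous; only the first-order term counts. Asking
  for an upper bound instead of a derivative makes the lemma apply at once to squared distances to a
  convex set and to costs whose gradient is Lipschitz on that set.
\<close>

lemma descent_along_curve:
  fixes u :: "real \<Rightarrow> 'a::real_inner" and \<phi> :: "'a \<Rightarrow> real"
  assumes "s \<le> t" "C \<ge> 0"
    and upper: "\<And>p q. p \<in> S \<Longrightarrow> q \<in> S \<Longrightarrow> \<phi> q \<le> \<phi> p + G p \<bullet> (q - p) + C * (norm (q - p))\<^sup>2"
    and u_in: "\<And>\<tau>. \<tau> \<in> {s..t} \<Longrightarrow> u \<tau> \<in> S"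
    and W: "continuous_on {s..t} W"
    and speed: "\<And>a b. s \<le> a \<Longrightarrow> a \<le> b \<Longrightarrow> b \<le> t \<Longrightarrow> norm (u b - u a) \<le> W b - W a"
    and slope: "\<And>\<eta>. \<eta> > 0 \<Longrightarrow> \<exists>\<delta>>0. \<forall>a b. s \<le> a \<longrightarrow> a \<le> b \<longrightarrow> b \<le> t \<longrightarrow> b - a < \<delta> \<longrightarrow>
        G (u a) \<bullet> (u b - u a) \<le> - (M b - M a) + \<eta> * (W b - W a)"
  shows "\<phi> (u t) + M t \<le> \<phi> (u s) + M s"
proof -
  have "\<exists>\<delta>>0. \<forall>a b. s \<le> a \<longrightarrow> a \<le> b \<longrightarrow> b \<le> t \<longrightarrow> b - a < \<delta> \<longrightarrow>
      (\<phi> (u b) + M b) - (\<phi> (u a) + M a) \<le> \<eta> * (W b - W a)" if \<eta>: "\<eta> > 0" for \<eta>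
  proof -
    obtain \<delta>1 where \<delta>1: "\<delta>1 > 0" "\<And>a b. s \<le> a \<Longrightarrow> a \<le> b \<Longrightarrow> b \<le> t \<Longrightarrow> b - a < \<delta>1 \<Longrightarrow>
        G (u a) \<bullet> (u b - u a) \<le> - (M b - M a) + \<eta> / 2 * (W b - W a)"
      using slope[of "\<eta> / 2"] \<eta> by auto
    have "uniformly_continuous_on {s..t} W"
      using W by (intro compact_uniformly_continuous) auto
    then obtain \<delta>2 where \<delta>2: "\<delta>2 > 0" "\<And>a b. a \<in> {s..t} \<Longrightarrow> b \<in> {s..t} \<Longrightarrow> dist b a < \<delta>2 \<Longrightarrow>
        dist (W b) (W a) < \<eta> / (2 * (C + 1))"
      unfolding uniformly_continuous_on_def using \<eta> \<open>C \<ge> 0\<close>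
      by (metis add_nonneg_pos mult_pos_pos zero_less_divide_iff zero_less_numeral zero_less_one)
    show ?thesis
    proof (intro exI[of _ "min \<delta>1 \<delta>2"] conjI allI impI)
      show "min \<delta>1 \<delta>2 > 0" using \<delta>1 \<delta>2 by simp
      fix a b assume ab: "s \<le> a" "a \<le> b" "b \<le> t" "b - a < min \<delta>1 \<delta>2"
      have sp: "norm (u b - u a) \<le> W b - W a" using speed ab by simp
      then have W0: "0 \<le> W b - W a" by (meson norm_ge_zero order_trans)
      have "W b - W a < \<eta> / (2 * (C + 1))"
        using \<delta>2(2)[of a b] ab by (auto simp: dist_real_def)
      then have small: "C * (W b - W a) \<le> \<eta> / 2"
        using \<open>C \<ge> 0\<close> \<eta> W0 by (simp add: field_simps)
      have "C * (norm (u b - u a))\<^sup>2 \<le> C * (W b - W a)\<^sup>2"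
        using sp \<open>C \<ge> 0\<close> by (intro mult_left_mono power_mono) auto
      also have "\<dots> = C * (W b - W a) * (W b - W a)" by (simp add: power2_eq_square)
      also have "\<dots> \<le> \<eta> / 2 * (W b - W a)" using small W0 by (rule mult_right_mono)
      finally have quad: "C * (norm (u b - u a))\<^sup>2 \<le> \<eta> / 2 * (W b - W a)" .
      have "\<phi> (u b) \<le> \<phi> (u a) + G (u a) \<bullet> (u b - u a) + C * (norm (u b - u a))\<^sup>2"
        using ab by (intro upper u_in) auto
      moreover have "G (u a) \<bullet> (u b - u a) \<le> - (M b - M a) + \<eta> / 2 * (W b - W a)"
        using \<delta>1(2) ab by simp
      ultimately show "(\<phi> (u b) + M b) - (\<phi> (u a) + M a) \<le> \<eta> * (W b - W a)"
        using quad by argo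
    qed
  qed
  with \<open>s \<le> t\<close> show ?thesis
    by (rule le_if_locally_almost_le[where g = "\<lambda>\<tau>. \<phi> (u \<tau>) + M \<tau>"]) blast
qed

lemma integral_diff_initial:
  fixes h :: "real \<Rightarrow> 'a::banach"
  assumes "h integrable_on {s..t}" "s \<le> a" "a \<le> b" "b \<le> t"
  shows "integral {a..b} h = integral {s..b} h - integral {s..a} h"
proof -
  have "h integrable_on {s..b}" using assms by (auto intro: integrable_on_subinterval)
  then have "integral {s..a} h + integral {a..b} h = integral {s..b} h"
    using assms Henstock_Kurzweil_Integration.integral_combine by blast
  then show ?thesis by (simp add: algebra_simps)
qed

text \<open>
  The chain rule inequality for a curve with velocity \<open>w\<close>. The integrable bound \<open>\<rho>\<close> on the speed
  provides the length function, and uniform continuity of \<open>G\<close> along the curve allows freezing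
  \<open>G (u a)\<close> on a short interval.
\<close>

lemma descent_along_integral_curve:
  fixes u w :: "real \<Rightarrow> 'a::euclidean_space" and \<phi> :: "'a \<Rightarrow> real"
  assumes "s \<le> t" "C \<ge> 0"
    and upper: "\<And>p q. p \<in> S \<Longrightarrow> q \<in> S \<Longrightarrow> \<phi> q \<le> \<phi> p + G p \<bullet> (q - p) + C * (norm (q - p))\<^sup>2"
    and u_in: "\<And>\<tau>. \<tau> \<in> {s..t} \<Longrightarrow> u \<tau> \<in> S"
    and G: "continuous_on {s..t} (\<lambda>\<tau>. G (u \<tau>))"
    and w: "\<And>a b. s \<le> a \<Longrightarrow> a \<le> b \<Longrightarrow> b \<le> t \<Longrightarrow> (w has_integral (u b - u a)) {a..b}"
    and w_le: "\<And>\<tau>. \<tau> \<in> {s..t} \<Longrightarrow> norm (w \<tau>) \<le> \<rho> \<tau>"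
    and \<rho>: "\<rho> integrable_on {s..t}"
    and m: "m integrable_on {s..t}"
    and slope: "\<And>\<tau>. \<tau> \<in> {s..t} \<Longrightarrow> G (u \<tau>) \<bullet> w \<tau> \<le> - m \<tau>"
  shows "\<phi> (u t) \<le> \<phi> (u s) - integral {s..t} m"
proof -
  let ?W = "\<lambda>\<tau>. integral {s..\<tau>} \<rho>" and ?M = "\<lambda>\<tau>. integral {s..\<tau>} m"
  have "\<phi> (u t) + ?M t \<le> \<phi> (u s) + ?M s"
  proof (rule descent_along_curve[OF \<open>s \<le> t\<close> \<open>C \<ge> 0\<close> upper u_in])
    show "continuous_on {s..t} ?W" using \<rho> by (rule indefinite_integral_continuous_1)
  next
    fix a b assume ab: "s \<le> a" "a \<le> b" "b \<le> t"
    have "norm (integral {a..b} w) \<le> integral {a..b} \<rho>"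
      using ab w[of a b] \<rho> w_le
      by (intro integral_norm_bound_integral) (auto intro: integrable_on_subinterval)
    then show "norm (u b - u a) \<le> ?W b - ?W a"
      using integral_unique[OF w[OF ab]] integral_diff_initial[OF \<rho> ab] by simp
  next
    fix \<eta> :: real assume \<eta>: "\<eta> > 0"
    have "uniformly_continuous_on {s..t} (\<lambda>\<tau>. G (u \<tau>))"
      using G by (intro compact_uniformly_continuous) auto
    then obtain \<delta> where \<delta>: "\<delta> > 0" "\<And>a b. a \<in> {s..t} \<Longrightarrow> b \<in> {s..t} \<Longrightarrow> dist b a < \<delta> \<Longrightarrow>
        dist (G (u b)) (G (u a)) < \<eta>"
      unfolding uniformly_continuous_on_def using \<eta> by metis
    have "G (u a) \<bullet> (u b - u a) \<le> - (?M b - ?M a) + \<eta> * (?W b - ?W a)"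
      if ab: "s \<le> a" "a \<le> b" "b \<le> t" "b - a < \<delta>" for a b
    proof -
      have int: "\<rho> integrable_on {a..b}" "m integrable_on {a..b}"
        using \<rho> m ab by (auto intro: integrable_on_subinterval)
      have "((\<lambda>\<tau>. G (u a) \<bullet> w \<tau>) has_integral (G (u a) \<bullet> (u b - u a))) {a..b}"
        using has_integral_linear[OF w bounded_linear_inner_right] ab by (simp add: o_def)
      moreover have "((\<lambda>\<tau>. - m \<tau> + \<eta> * \<rho> \<tau>) has_integral
          (- integral {a..b} m + \<eta> * integral {a..b} \<rho>)) {a..b}"
        using int by (intro has_integral_add has_integral_neg has_integral_mult_right
            integrable_integral)
      moreover have "G (u a) \<bullet> w \<tau> \<le> - m \<tau> + \<eta> * \<rho> \<tau>" if \<tau>: "\<tau> \<in> {a..b}" for \<tau>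
      proof -
        have "(G (u a) - G (u \<tau>)) \<bullet> w \<tau> \<le> norm (G (u a) - G (u \<tau>)) * norm (w \<tau>)"
          by (rule norm_cauchy_schwarz)
        also have "\<dots> \<le> \<eta> * \<rho> \<tau>"
          using \<delta>(2)[of \<tau> a] w_le[of \<tau>] ab \<tau> \<eta>
          by (intro mult_mono) (auto simp: dist_norm)
        finally show ?thesis using slope[of \<tau>] ab \<tau> by (simp add: inner_diff_left)
      qed
      ultimately have "G (u a) \<bullet> (u b - u a) \<le> - integral {a..b} m + \<eta> * integral {a..b} \<rho>"
        by (rule has_integral_le)
      then show ?thesis
        using integral_diff_initial[OF \<rho> ab(1-3)] integral_diff_initial[OF m ab(1-3)] by simp
    qed
    with \<delta>(1) show "\<exists>\<delta>>0. \<forall>a b. s \<le> a \<longrightarrow> a \<le> b \<longrightarrow> b \<le> t \<longrightarrow> b - a < \<delta> \<longrightarrow>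
        G (u a) \<bullet> (u b - u a) \<le> - (?M b - ?M a) + \<eta> * (?W b - ?W a)"
      by blast
  qed auto
  then show ?thesis by simp
qed

text \<open>
  Above the level \<open>r\<close>, \<open>V\<close> loses at least what \<open>B\<close> gains. It cannot stay above forever, since
  \<open>B\<close> diverges and \<open>V\<close> is nonnegative; and it cannot climb back, because from its last visit to the
  level \<open>r\<close> onwards it would have to decrease.
\<close>

lemma eventually_le_if_decreasing_above:
  fixes V B :: "real \<Rightarrow> real"
  assumes V: "continuous_on {T..} V" "\<And>t. t \<ge> T \<Longrightarrow> 0 \<le> V t"
    and B: "mono_on {T..} B" "filterlim B at_top at_top"
    and decay: "\<And>s t. T \<le> s \<Longrightarrow> s \<le> t \<Longrightarrow> (\<And>\<tau>. \<tau> \<in> {s..t} \<Longrightarrow> r \<le> V \<tau>) \<Longrightarrow>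
                  V t + B t \<le> V s + B s"
  shows "\<forall>\<^sub>F t in at_top. V t \<le> r"
proof -
  obtain s where s: "s \<ge> T" "V s \<le> r"
  proof (rule ccontr)
    assume "\<not> thesis"
    with that have above: "V \<tau> > r" if "\<tau> \<ge> T" for \<tau> using that by (meson not_le)
    have "\<forall>\<^sub>F t in at_top. B t > V T + B T \<and> t \<ge> T"
      using B(2) by (intro eventually_conj eventually_ge_at_top) (simp add: filterlim_at_top_dense)
    then obtain t where t: "B t > V T + B T" "t \<ge> T"
      using eventually_happens'[OF trivial_limit_at_top_linorder] by blast
    have "V t + B t \<le> V T + B T"
      using t(2) above by (intro decay) (auto intro: less_imp_le)
    with t V(2)[OF t(2)] show False by linarith
  qed
  have "V t \<le> r" if t: "t \<ge> s" for t
  proof (rule ccontr)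
    assume "\<not> V t \<le> r"
    then have gt: "V t > r" by simp
    have cont: "continuous_on {s..t} V" using V(1) s by (auto intro: continuous_on_subset)
    \<comment> \<open>The last time up to \<open>t\<close> at which \<open>V\<close> is at most \<open>r\<close>.\<close>
    define L where "L = {\<tau> \<in> {s..t}. V \<tau> \<le> r}"
    have "L = {s..t} \<inter> V -` {..r}" by (auto simp: L_def)
    then have "closed L"
      using continuous_closed_preimage[OF cont, of "{..r}"] by simp
    moreover have "bounded L"
      by (rule bounded_subset[of "{s..t}"]) (auto simp: L_def)
    moreover have "s \<in> L" using s t by (simp add: L_def)
    ultimately obtain l where l: "l \<in> L" "\<And>\<tau>. \<tau> \<in> L \<Longrightarrow> \<tau> \<le> l"
      using compact_attains_sup[of L] compact_eq_bounded_closed by blast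
    have lt: "s \<le> l" "l < t" "V l \<le> r" using l(1) gt by (auto simp: L_def order_less_le)
    have after: "V \<tau> > r" if "l < \<tau>" "\<tau> \<le> t" for \<tau>
      using l(2)[of \<tau>] that lt by (force simp: L_def)
    have "V l = r"
    proof (rule ccontr)
      assume "V l \<noteq> r"
      with lt have "V l < r" by simp
      moreover have "continuous_on {l..t} V" using cont lt by (auto intro: continuous_on_subset)
      ultimately obtain \<tau> where \<tau>: "l \<le> \<tau>" "\<tau> \<le> t" "V \<tau> = r"
        using IVT'[of V l r t] gt lt by auto
      then show False using after[of \<tau>] \<open>V l < r\<close> by (cases "\<tau> = l") auto
    qed
    have "V t + B t \<le> V l + B l"
    proof (rule decay)
      show "T \<le> l" "l \<le> t" using lt s by auto
      fix \<tau> assume "\<tau> \<in> {l..t}"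
      then show "r \<le> V \<tau>" using after[of \<tau>] \<open>V l = r\<close> by (cases "\<tau> = l") auto
    qed
    moreover have "B l \<le> B t" using B(1) lt s by (auto simp: mono_on_def)
    ultimately show False using gt lt by linarith
  qed
  then show ?thesis unfolding eventually_at_top_linorder by blast
qed

section \<open>Disagreement and the Laplacian flow on a weight-balanced digraph\<close>

definition average :: "'a::real_vector^'v \<Rightarrow> 'a" where
  "average U = (1 / real CARD('v)) *\<^sub>R (\<Sum>i\<in>UNIV. U $ i)"

definition disagreement :: "'a::real_vector^'v \<Rightarrow> 'a^'v" where
  "disagreement U = (\<chi> i. U $ i - average U)"

text \<open>
  Minus the graph Laplacian, acting on stacked vectors.
\<close>

definition laplacian_flow :: "real^'v^'v \<Rightarrow> 'a::real_vector^'v \<Rightarrow> 'a^'v" where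
  "laplacian_flow A U = (\<chi> i. \<Sum>j\<in>UNIV. A $ i $ j *\<^sub>R (U $ j - U $ i))"

lemma linear_average: "linear (average :: 'a::real_vector^'v \<Rightarrow> 'a)"
  by (rule linearI) (simp_all add: average_def sum.distrib scaleR_add_right scaleR_sum_right mult.commute)

lemma linear_disagreement: "linear (disagreement :: 'a::real_vector^'v \<Rightarrow> 'a^'v)"
  by (rule linearI)
     (simp_all add: disagreement_def vec_eq_iff linear_add[OF linear_average]
        linear_cmul[OF linear_average] scaleR_diff_right)

lemma linear_laplacian_flow: "linear (laplacian_flow A :: 'a::real_vector^'v \<Rightarrow> 'a^'v)"
  by (rule linearI)
     (simp_all add: laplacian_flow_def vec_eq_iff sum.distrib[symmetric] scaleR_sum_right
        algebra_simps)

lemma bounded_linear_average: "bounded_linear (average :: 'a::euclidean_space^'v \<Rightarrow> 'a)"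
  by (rule linear_conv_bounded_linear[THEN iffD1, OF linear_average])

lemma bounded_linear_laplacian_flow:
  "bounded_linear (laplacian_flow A :: 'a::euclidean_space^'v \<Rightarrow> 'a^'v)"
  by (rule linear_conv_bounded_linear[THEN iffD1, OF linear_laplacian_flow])

lemma bounded_linear_disagreement:
  "bounded_linear (disagreement :: 'a::euclidean_space^'v \<Rightarrow> 'a^'v)"
  by (rule linear_conv_bounded_linear[THEN iffD1, OF linear_disagreement])

lemma average_in_convex:
  fixes U :: "'a::real_vector^'v"
  assumes "convex C" "\<And>i. U $ i \<in> C"
  shows "average U \<in> C"
proof -
  have "average U = (\<Sum>i\<in>UNIV. (1 / real CARD('v)) *\<^sub>R (U $ i))"
    by (simp add: average_def scaleR_sum_right)
  also have "\<dots> \<in> C" using assms by (intro convex_sum) auto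
  finally show ?thesis .
qed

lemma norm_average_le:
  fixes U :: "'a::real_normed_vector^'v"
  assumes "\<And>i. norm (U $ i) \<le> r"
  shows "norm (average U) \<le> r"
  using average_in_convex[of "cball 0 r" U] assms by simp

lemma inner_average_le:
  "(\<And>i. c \<bullet> (U $ i) \<le> (r::real)) \<Longrightarrow> c \<bullet> average (U :: 'a::real_inner^'v) \<le> r"
  using average_in_convex[of "{p. c \<bullet> p \<le> r}" U] convex_halfspace_le[of c r] by simp

lemma norm_vec_le_card:
  fixes U :: "'a::real_normed_vector^'v"
  assumes "\<And>i. norm (U $ i) \<le> r"
  shows "norm U \<le> real CARD('v) * r"
proof -
  have "norm U \<le> (\<Sum>i\<in>UNIV. norm (U $ i))"
    unfolding norm_vec_def by (rule L2_set_le_sum) simp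
  also have "\<dots> \<le> (\<Sum>i\<in>(UNIV::'v set). r)" by (intro sum_mono assms)
  finally show ?thesis by simp
qed

lemma sum_eq_average: "(\<Sum>i\<in>UNIV. U $ i) = real CARD('v) *\<^sub>R average (U :: 'a::real_vector^'v)"
  by (simp add: average_def)

lemma sum_disagreement: "(\<Sum>i\<in>UNIV. disagreement (U :: 'a::real_vector^'v) $ i) = 0"
  by (simp add: disagreement_def sum_subtractf sum_eq_average sum_constant_scaleR)

text \<open>
  The disagreement is the orthogonal projection onto the stacked vectors of sum zero.
\<close>

lemma inner_disagreement_left:
  fixes U :: "'a::real_inner^'v"
  shows "disagreement U \<bullet> disagreement V = disagreement U \<bullet> V"
proof -
  have "disagreement U \<bullet> disagreement V =
      disagreement U \<bullet> V - (\<Sum>i\<in>UNIV. disagreement U $ i) \<bullet> average V"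
    unfolding disagreement_def[of V]
    by (simp add: inner_vec_def inner_diff_right sum_subtractf inner_sum_left)
  then show ?thesis by (simp add: sum_disagreement)
qed

lemma norm_disagreement_le: "norm (disagreement (U :: 'a::real_inner^'v)) \<le> norm U"
proof -
  have "norm (disagreement U) * norm (disagreement U) = disagreement U \<bullet> U"
    by (metis inner_disagreement_left norm_eq_sqrt_inner real_sqrt_mult_self abs_of_nonneg inner_ge_zero)
  also have "\<dots> \<le> norm (disagreement U) * norm U" by (rule norm_cauchy_schwarz)
  finally show ?thesis
    by (metis mult_le_cancel_left_pos norm_ge_zero order_le_less)
qed

lemma laplacian_flow_disagreement: "laplacian_flow A (disagreement U) = laplacian_flow A U"
  by (simp add: laplacian_flow_def disagreement_def)

text \<open>
  Each \<open>h i\<close> is added with the \<open>i\<close>-th column sum of \<open>A\<close> and subtracted with the \<open>i\<close>-th row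
  sum, which agree. Taken for vectors this shows that the flow preserves averages, and taken for
  squared norms that it dissipates.
\<close>

lemma weight_balanced_sum_differences:
  fixes h :: "'v::finite \<Rightarrow> 'b::real_vector"
  assumes "weight_balanced A"
  shows "(\<Sum>i\<in>UNIV. \<Sum>j\<in>UNIV. A $ i $ j *\<^sub>R (h j - h i)) = 0"
proof -
  have "(\<Sum>i\<in>UNIV. \<Sum>j\<in>UNIV. A $ i $ j *\<^sub>R h j) = (\<Sum>j\<in>UNIV. (\<Sum>i\<in>UNIV. A $ i $ j) *\<^sub>R h j)"
    by (subst sum.swap) (simp add: scaleR_sum_left)
  also have "\<dots> = (\<Sum>j\<in>UNIV. (\<Sum>i\<in>UNIV. A $ j $ i) *\<^sub>R h j)"
    using assms by (simp add: weight_balanced_def)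
  also have "\<dots> = (\<Sum>i\<in>UNIV. \<Sum>j\<in>UNIV. A $ i $ j *\<^sub>R h i)"
    by (simp add: scaleR_sum_left)
  finally show ?thesis by (simp add: scaleR_diff_right sum_subtractf)
qed

lemma average_laplacian_flow:
  assumes "weight_balanced A"
  shows "average (laplacian_flow A U) = 0"
  using weight_balanced_sum_differences[OF assms, of "\<lambda>i. U $ i"]
  by (simp add: average_def laplacian_flow_def)

text \<open>
  Polarisation turns \<open>p \<bullet> (q - p)\<close> into half of
  \<open>(norm q)\<^sup>2 - (norm p)\<^sup>2 - (norm (q - p))\<^sup>2\<close>, and the first two terms cancel in the weighted
  sum by balance. For a matrix that is not symmetric the symmetric part of the flow is thus still a
  graph Laplacian.
\<close>

lemma inner_laplacian_flow:
  fixes U :: "'a::real_inner^'v"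
  assumes "weight_balanced A"
  shows "U \<bullet> laplacian_flow A U =
    - (1/2) * (\<Sum>i\<in>UNIV. \<Sum>j\<in>UNIV. A $ i $ j * (norm (U $ j - U $ i))\<^sup>2)"
proof -
  have square: "p \<bullet> (q - p) = 1/2 * (p' - p'') - 1/2 * (norm (q - p))\<^sup>2"
    if "p' = (norm q)\<^sup>2" "p'' = (norm p)\<^sup>2" for p q :: 'a and p' p''
    unfolding that power2_norm_eq_inner by (simp add: inner_diff inner_commute algebra_simps)
  have "U \<bullet> laplacian_flow A U = (\<Sum>i\<in>UNIV. \<Sum>j\<in>UNIV. A $ i $ j * (U $ i \<bullet> (U $ j - U $ i)))"
    by (simp add: inner_vec_def laplacian_flow_def inner_sum_right)
  also have "\<dots> = (\<Sum>i\<in>UNIV. \<Sum>j\<in>UNIV.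
      1/2 * (A $ i $ j *\<^sub>R ((norm (U $ j))\<^sup>2 - (norm (U $ i))\<^sup>2)) -
      1/2 * (A $ i $ j * (norm (U $ j - U $ i))\<^sup>2))"
    by (subst square[OF refl refl]) (simp add: algebra_simps)
  also have "\<dots> = 1/2 * (\<Sum>i\<in>UNIV. \<Sum>j\<in>UNIV. A $ i $ j *\<^sub>R ((norm (U $ j))\<^sup>2 - (norm (U $ i))\<^sup>2))
      - 1/2 * (\<Sum>i\<in>UNIV. \<Sum>j\<in>UNIV. A $ i $ j * (norm (U $ j - U $ i))\<^sup>2)"
    unfolding sum_subtractf sum_distrib_left ..
  also have "\<dots> = - (1/2) * (\<Sum>i\<in>UNIV. \<Sum>j\<in>UNIV. A $ i $ j * (norm (U $ j - U $ i))\<^sup>2)"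
    unfolding weight_balanced_sum_differences[OF assms, of "\<lambda>i. (norm (U $ i))\<^sup>2"] by simp
  finally show ?thesis .
qed

lemma adjacency_matrix_nonneg: "adjacency_matrix E A \<Longrightarrow> A $ i $ j \<ge> 0"
  unfolding adjacency_matrix_def by (metis less_eq_real_def)

lemma strongly_connected_imp_constant:
  assumes "strongly_connected E" and edge: "\<And>i j. (i, j) \<in> E \<Longrightarrow> h i = h j"
  shows "h i = h j"
proof -
  have "(i, j) \<in> E\<^sup>*" using assms(1) by (simp add: strongly_connected_def)
  then show ?thesis by (induction rule: rtrancl_induct) (auto dest: edge)
qed

text \<open>
  The dissipation is a quadratic form that vanishes only when all neighbours agree, hence by
  connectivity only on constant vectors. On the compact unit sphere of the vectors of sum zero it
  therefore has a positive minimum, and homogeneity carries this over to all vectors.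
\<close>

lemma disagreement_dissipation:
  fixes E :: "('v::finite \<times> 'v) set" and A :: "real^'v^'v"
  assumes graph: "adjacency_matrix E A" "strongly_connected E" "weight_balanced A"
  obtains \<mu> where "\<mu> > 0"
    "\<And>U :: 'a::euclidean_space^'v. disagreement U \<bullet> laplacian_flow A U \<le> - \<mu> * (norm (disagreement U))\<^sup>2"
proof -
  define Q where "Q D = - (D \<bullet> laplacian_flow A D)" for D :: "'a^'v"
  define K where "K = sphere 0 1 \<inter> {D :: 'a^'v. (\<Sum>i\<in>UNIV. D $ i) = 0}"
  have "closed {D :: 'a^'v. (\<Sum>i\<in>UNIV. D $ i) = 0}"
    by (intro closed_Collect_eq continuous_intros)
  then have K: "compact K" unfolding K_def by (intro compact_Int_closed) auto
  have contQ: "continuous_on K Q"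
    unfolding Q_def using linear_continuous_on[OF bounded_linear_laplacian_flow]
    by (intro continuous_intros)
  have Q_pos: "Q D > 0" if "D \<in> K" for D
  proof -
    let ?q = "\<lambda>i j. A $ i $ j * (norm (D $ j - D $ i))\<^sup>2"
    have q: "?q i j \<ge> 0" for i j using adjacency_matrix_nonneg[OF graph(1)] by simp
    have Q: "Q D = 1/2 * (\<Sum>i\<in>UNIV. \<Sum>j\<in>UNIV. ?q i j)"
      by (simp add: Q_def inner_laplacian_flow[OF graph(3)])
    have "Q D \<noteq> 0"
    proof
      assume "Q D = 0"
      then have "(\<Sum>i\<in>UNIV. \<Sum>j\<in>UNIV. ?q i j) = 0" using Q by simp
      then have zero: "?q i j = 0" for i j
        using q by (simp add: sum_nonneg_eq_0_iff sum_nonneg)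
      have "D $ i = D $ j" if "(i, j) \<in> E" for i j
        using zero[of i j] that graph(1) by (force simp: adjacency_matrix_def)
      then have const: "D $ i = D $ j" for i j
        by (rule strongly_connected_imp_constant[OF graph(2)])
      have "D $ i = 0" for i
      proof -
        have "0 = (\<Sum>j\<in>UNIV. D $ j)" using that by (simp add: K_def)
        also have "\<dots> = (\<Sum>j\<in>(UNIV::'v set). D $ i)" using const by (intro sum.cong) auto
        finally show ?thesis by (simp add: sum_constant_scaleR)
      qed
      then have "D = 0" by (simp add: vec_eq_iff)
      with that show False by (simp add: K_def)
    qed
    moreover have "Q D \<ge> 0" unfolding Q by (intro mult_nonneg_nonneg sum_nonneg q) auto
    ultimately show ?thesis by simp
  qed
  obtain \<mu> where \<mu>: "\<mu> > 0" "\<And>D. D \<in> K \<Longrightarrow> \<mu> \<le> Q D"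
  proof (cases "K = {}")
    \<comment> \<open>A single agent never disagrees, so any constant will do.\<close>
    case True
    then show ?thesis using that[of 1] by simp
  next
    case False
    then obtain D where "D \<in> K" "\<And>D'. D' \<in> K \<Longrightarrow> Q D \<le> Q D'"
      using continuous_attains_inf[OF K False contQ] by blast
    then show ?thesis using that[of "Q D"] Q_pos by blast
  qed
  show ?thesis
  proof (rule that[OF \<mu>(1)])
    fix U :: "'a^'v"
    let ?D = "disagreement U"
    show "?D \<bullet> laplacian_flow A U \<le> - \<mu> * (norm ?D)\<^sup>2"
    proof (cases "?D = 0")
      case False
      let ?e = "(1 / norm ?D) *\<^sub>R ?D"
      have "(\<Sum>i\<in>UNIV. ?e $ i) = (1 / norm ?D) *\<^sub>R (\<Sum>i\<in>UNIV. ?D $ i)"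
        by (simp add: scaleR_sum_right)
      then have "?e \<in> K" using False by (simp add: K_def sum_disagreement)
      then have "\<mu> \<le> Q ?e" by (rule \<mu>(2))
      also have "Q ?e = (1 / norm ?D)\<^sup>2 * Q ?D"
        by (simp add: Q_def linear_cmul[OF linear_laplacian_flow] power2_eq_square)
      finally have "\<mu> * (norm ?D)\<^sup>2 \<le> Q ?D"
        using False by (simp add: field_simps power_divide)
      then show ?thesis by (simp add: Q_def laplacian_flow_disagreement)
    qed simp
  qed
qed

section \<open>Consensus under a slowly varying perturbation\<close>

text \<open>
  With \<open>n\<close> the norm of the disagreement, \<open>n\<^sup>2\<close> changes at a rate of at most
  \<open>- 2 * \<mu> * n\<^sup>2 + 2 * n * \<epsilon>\<close>. For \<open>\<epsilon> = \<mu> * r / 2\<close> this is at most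
  \<open>- \<mu> * r\<^sup>2\<close> as long as \<open>n \<ge> r\<close>, so eventually \<open>n \<le> r\<close>.
  The perturbation is described by its increments because the lemma has to apply
  to gradients along a trajectory, for which no velocity is known.
\<close>

lemma perturbed_consensus:
  fixes U R :: "real \<Rightarrow> 'a::euclidean_space^'v" and E :: "('v \<times> 'v) set"
  assumes graph: "adjacency_matrix E A" "strongly_connected E" "weight_balanced A"
    and U: "continuous_on {T0..} U"
    and flow: "\<And>a b. T0 \<le> a \<Longrightarrow> a \<le> b \<Longrightarrow>
      U b - U a = integral {a..b} (\<lambda>\<tau>. laplacian_flow A (U \<tau>)) + (R b - R a)"
    and slow: "\<And>\<epsilon>. \<epsilon> > 0 \<Longrightarrow> \<exists>T. \<forall>a b. T \<le> a \<longrightarrow> a \<le> b \<longrightarrow> norm (R b - R a) \<le> \<epsilon> * (b - a)"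
  shows "((\<lambda>t. disagreement (U t)) \<longlongrightarrow> 0) at_top"
proof -
  obtain \<mu> where \<mu>: "\<mu> > 0" and dissip: "\<And>U :: 'a^'v.
      disagreement U \<bullet> laplacian_flow A U \<le> - \<mu> * (norm (disagreement U))\<^sup>2"
    using disagreement_dissipation[OF graph] by blast
  let ?n = "\<lambda>t. norm (disagreement (U t))"
  have cont_lap: "continuous_on {T0..} (\<lambda>\<tau>. laplacian_flow A (U \<tau>))"
    by (rule bounded_linear.continuous_on[OF bounded_linear_laplacian_flow U])
  have cont_dis: "continuous_on {T0..} (\<lambda>\<tau>. disagreement (U \<tau>))"
    by (rule bounded_linear.continuous_on[OF bounded_linear_disagreement U])
  have small: "\<forall>\<^sub>F t in at_top. (?n t)\<^sup>2 \<le> r\<^sup>2" if r: "r > 0" for r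
  proof -
    \<comment> \<open>Small enough for the perturbation to consume at most half of the dissipation above \<open>r\<close>.\<close>
    define \<epsilon> where "\<epsilon> = \<mu> * r / 2"
    have \<epsilon>: "\<epsilon> > 0" using \<mu> r by (simp add: \<epsilon>_def)
    obtain T1 where T1: "\<And>a b. T1 \<le> a \<Longrightarrow> a \<le> b \<Longrightarrow> norm (R b - R a) \<le> \<epsilon> * (b - a)"
      using slow[OF \<epsilon>] by blast
    define T where "T = max T0 T1"
    show ?thesis
    proof (rule eventually_le_if_decreasing_above[where T = T and B = "\<lambda>t. (\<mu> * r\<^sup>2) * t"])
      show "continuous_on {T..} (\<lambda>t. (?n t)\<^sup>2)"
        by (intro continuous_on_power continuous_on_norm continuous_on_subset[OF cont_dis])
          (simp add: T_def)
      show "mono_on {T..} (\<lambda>t. \<mu> * r\<^sup>2 * t)"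
        using \<mu> by (auto simp: mono_on_def intro: mult_left_mono)
      show "LIM t at_top. \<mu> * r\<^sup>2 * t :> at_top"
        using \<mu> r by (intro filterlim_tendsto_pos_mult_at_top[OF tendsto_const] filterlim_ident) auto
    next
      fix s t assume st: "T \<le> s" "s \<le> t" and above: "\<And>\<tau>. \<tau> \<in> {s..t} \<Longrightarrow> r\<^sup>2 \<le> (?n \<tau>)\<^sup>2"
      have sub: "{s..t} \<subseteq> {T0..}" using st by (auto simp: T_def)
      have lap: "continuous_on {s..t} (\<lambda>\<tau>. laplacian_flow A (U \<tau>))"
        using cont_lap sub by (rule continuous_on_subset)
      have lap_int: "(\<lambda>\<tau>. laplacian_flow A (U \<tau>)) integrable_on {a..b}"
        if "s \<le> a" "b \<le> t" for a b
        using that by (intro integrable_continuous_real continuous_on_subset[OF lap]) auto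
      have "bounded ((\<lambda>\<tau>. laplacian_flow A (U \<tau>)) ` {s..t})"
        using lap by (intro compact_imp_bounded compact_continuous_image) auto
      then obtain K0 where K0: "\<And>\<tau>. \<tau> \<in> {s..t} \<Longrightarrow> norm (laplacian_flow A (U \<tau>)) \<le> K0"
        unfolding bounded_iff by blast
      have "bounded ((\<lambda>\<tau>. disagreement (U \<tau>)) ` {s..t})"
        using continuous_on_subset[OF cont_dis sub]
        by (intro compact_imp_bounded compact_continuous_image) auto
      then obtain N where N: "\<And>\<tau>. \<tau> \<in> {s..t} \<Longrightarrow> ?n \<tau> \<le> N"
        unfolding bounded_iff by blast
      have N0: "N \<ge> 0" using N[of s] st by (meson atLeastAtMost_iff norm_ge_zero order_refl order_trans)
      \<comment> \<open>A bound on the speed; the summand 1 makes an error of size \<open>\<eta> * (b - a)\<close> at most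
        \<open>\<eta> * K * (b - a)\<close>.\<close>
      define K where "K = \<bar>K0\<bar> + \<epsilon> + 1"
      have R_le: "norm (R b - R a) \<le> \<epsilon> * (b - a)" if "s \<le> a" "a \<le> b" for a b
        using T1 that st by (auto simp: T_def)
      have flow': "U b - U a = integral {a..b} (\<lambda>\<tau>. laplacian_flow A (U \<tau>)) + (R b - R a)"
        if "s \<le> a" "a \<le> b" for a b
        using flow that st by (auto simp: T_def)
      show "(?n t)\<^sup>2 + \<mu> * r\<^sup>2 * t \<le> (?n s)\<^sup>2 + \<mu> * r\<^sup>2 * s"
      proof (rule descent_along_curve[where u = U and \<phi> = "\<lambda>U. (norm (disagreement U))\<^sup>2" and
            S = UNIV and C = 1 and W = "\<lambda>\<tau>. K * \<tau>" and
            G = "\<lambda>U. 2 *\<^sub>R disagreement U" and M = "\<lambda>\<tau>. \<mu> * r\<^sup>2 * \<tau>", OF st(2)])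
        fix p q :: "'a^'v"
        have "disagreement q = disagreement p + disagreement (q - p)"
          by (simp flip: linear_add[OF linear_disagreement])
        then have "(norm (disagreement q))\<^sup>2 = (norm (disagreement p))\<^sup>2
            + 2 * (disagreement p \<bullet> disagreement (q - p)) + (norm (disagreement (q - p)))\<^sup>2"
          by (simp add: power2_norm_eq_inner inner_add inner_commute)
        also have "(norm (disagreement (q - p)))\<^sup>2 \<le> (norm (q - p))\<^sup>2"
          by (intro power_mono norm_disagreement_le) simp
        finally show "(norm (disagreement q))\<^sup>2 \<le> (norm (disagreement p))\<^sup>2
            + 2 *\<^sub>R disagreement p \<bullet> (q - p) + 1 * (norm (q - p))\<^sup>2"
          by (simp add: inner_disagreement_left)
      next
        show "continuous_on {s..t} (\<lambda>\<tau>. K * \<tau>)" by (intro continuous_intros)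
      next
        fix a b assume ab: "s \<le> a" "a \<le> b" "b \<le> t"
        have "norm (integral {a..b} (\<lambda>\<tau>. laplacian_flow A (U \<tau>))) \<le> integral {a..b} (\<lambda>_. \<bar>K0\<bar>)"
          using ab by (intro integral_norm_bound_integral lap_int order_trans[OF K0]) auto
        then have "norm (integral {a..b} (\<lambda>\<tau>. laplacian_flow A (U \<tau>))) \<le> \<bar>K0\<bar> * (b - a)"
          using ab by (simp add: mult.commute)
        then have "norm (U b - U a) \<le> \<bar>K0\<bar> * (b - a) + \<epsilon> * (b - a)"
          using R_le[OF ab(1,2)] unfolding flow'[OF ab(1,2)]
          by (intro order_trans[OF norm_triangle_ineq] add_mono)
        also have "\<dots> \<le> K * (b - a)" using ab by (simp add: K_def algebra_simps)
        finally show "norm (U b - U a) \<le> K * b - K * a" by (simp add: algebra_simps)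
      next
        fix \<eta> :: real assume \<eta>: "\<eta> > 0"
        define \<eta>' where "\<eta>' = \<eta> / (2 * (N + 1))"
        have \<eta>': "\<eta>' > 0" "2 * N * \<eta>' \<le> \<eta>" using \<eta> N0 by (auto simp: \<eta>'_def field_simps)
        have "uniformly_continuous_on {s..t} (\<lambda>\<tau>. laplacian_flow A (U \<tau>))"
          using lap by (intro compact_uniformly_continuous) auto
        then obtain \<delta> where \<delta>: "\<delta> > 0" "\<And>a b. a \<in> {s..t} \<Longrightarrow> b \<in> {s..t} \<Longrightarrow> dist b a < \<delta> \<Longrightarrow>
            dist (laplacian_flow A (U b)) (laplacian_flow A (U a)) < \<eta>'"
          unfolding uniformly_continuous_on_def using \<eta>'(1) by metis
        have "2 *\<^sub>R disagreement (U a) \<bullet> (U b - U a)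
            \<le> - (\<mu> * r\<^sup>2 * b - \<mu> * r\<^sup>2 * a) + \<eta> * (K * b - K * a)"
          if ab: "s \<le> a" "a \<le> b" "b \<le> t" "b - a < \<delta>" for a b
        proof -
          let ?d = "disagreement (U a)"
          have a: "a \<in> {s..t}" using ab by auto
          have "r \<le> norm ?d" using above[OF a] by (rule power2_le_imp_le) simp
          have le: "(2 *\<^sub>R ?d) \<bullet> laplacian_flow A (U \<tau>) \<le> - 2 * \<mu> * (norm ?d)\<^sup>2 + \<eta>"
            if \<tau>: "\<tau> \<in> {a..b}" for \<tau>
          proof -
            have "?d \<bullet> (laplacian_flow A (U \<tau>) - laplacian_flow A (U a))
                \<le> norm ?d * norm (laplacian_flow A (U \<tau>) - laplacian_flow A (U a))"
              by (rule norm_cauchy_schwarz)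
            also have "\<dots> \<le> N * \<eta>'"
              using \<delta>(2)[of a \<tau>] \<tau> ab N[OF a] N0
              by (intro mult_mono) (auto simp: dist_norm)
            finally show ?thesis using dissip[of "U a"] \<eta>'(2) by (simp add: inner_diff_right)
          qed
          have int: "((\<lambda>\<tau>. (2 *\<^sub>R ?d) \<bullet> laplacian_flow A (U \<tau>)) has_integral
              ((2 *\<^sub>R ?d) \<bullet> integral {a..b} (\<lambda>\<tau>. laplacian_flow A (U \<tau>)))) {a..b}"
            using has_integral_linear[OF integrable_integral[OF lap_int[OF ab(1,3)]]
                bounded_linear_inner_right[of "2 *\<^sub>R ?d"]]
            unfolding o_def .
          have int': "((\<lambda>_. - 2 * \<mu> * (norm ?d)\<^sup>2 + \<eta>) has_integral
              ((b - a) * (- 2 * \<mu> * (norm ?d)\<^sup>2 + \<eta>))) {a..b}"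
            using has_integral_const_real[of "- 2 * \<mu> * (norm ?d)\<^sup>2 + \<eta>" a b] ab by simp
          have flow_part: "(2 *\<^sub>R ?d) \<bullet> integral {a..b} (\<lambda>\<tau>. laplacian_flow A (U \<tau>))
              \<le> (b - a) * (- 2 * \<mu> * (norm ?d)\<^sup>2 + \<eta>)"
            using int int' le by (rule has_integral_le)
          have "?d \<bullet> (R b - R a) \<le> norm ?d * norm (R b - R a)"
            by (rule norm_cauchy_schwarz)
          also have "\<dots> \<le> norm ?d * (\<epsilon> * (b - a))"
            using R_le[OF ab(1,2)] by (rule mult_left_mono) simp
          also have "\<dots> = (b - a) * (\<mu> * norm ?d * r) / 2" by (simp add: \<epsilon>_def)
          also have "\<dots> \<le> (b - a) * (\<mu> * norm ?d * norm ?d) / 2"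
            using \<open>r \<le> norm ?d\<close> \<mu> ab by (intro divide_right_mono mult_left_mono) auto
          finally have "(2 *\<^sub>R ?d) \<bullet> (R b - R a) \<le> (b - a) * (\<mu> * (norm ?d)\<^sup>2)"
            by (simp add: power2_eq_square mult.assoc)
          with flow_part have "(2 *\<^sub>R ?d) \<bullet> (U b - U a)
              \<le> (b - a) * (- 2 * \<mu> * (norm ?d)\<^sup>2 + \<eta>) + (b - a) * (\<mu> * (norm ?d)\<^sup>2)"
            unfolding flow'[OF ab(1,2)] inner_add_right by linarith
          also have "\<dots> = (b - a) * (- (\<mu> * (norm ?d)\<^sup>2) + \<eta>)" by (simp add: algebra_simps)
          also have "\<dots> \<le> (b - a) * (- (\<mu> * r\<^sup>2) + \<eta> * K)"
          proof (intro mult_left_mono add_mono)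
            show "- (\<mu> * (norm ?d)\<^sup>2) \<le> - (\<mu> * r\<^sup>2)" using above[OF a] \<mu> by simp
            show "\<eta> \<le> \<eta> * K" using \<eta> \<epsilon> by (simp add: K_def)
          qed (use ab in auto)
          finally show ?thesis by (simp add: algebra_simps)
        qed
        with \<delta>(1) show "\<exists>\<delta>>0. \<forall>a b. s \<le> a \<longrightarrow> a \<le> b \<longrightarrow> b \<le> t \<longrightarrow> b - a < \<delta> \<longrightarrow>
            2 *\<^sub>R disagreement (U a) \<bullet> (U b - U a)
            \<le> - (\<mu> * r\<^sup>2 * b - \<mu> * r\<^sup>2 * a) + \<eta> * (K * b - K * a)"
          by blast
      qed auto
    qed simp
  qed
  show ?thesis
  proof (rule tendstoI)
    fix e :: real assume e: "e > 0"
    have "\<forall>\<^sub>F t in at_top. (?n t)\<^sup>2 \<le> (e / 2)\<^sup>2" using small[of "e / 2"] e by simp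
    then show "\<forall>\<^sub>F t in at_top. dist (disagreement (U t)) 0 < e"
    proof eventually_elim
      case (elim t)
      then have "?n t \<le> e / 2" using e power2_le_imp_le[of "?n t" "e / 2"] by linarith
      then show ?case using e by simp
    qed
  qed
qed

section \<open>Invariance of the feasible set\<close>

text \<open>
  With \<open>e p\<close> the vector from the projection of \<open>p\<close> onto \<open>\<Omega>\<close> to \<open>p\<close>, the squared distance is bounded
  above by a quadratic with slope \<open>2 * e p\<close>, since the old projection remains a competitor for
  the new point. A step towards a point of \<open>\<Omega>\<close> has a nonpositive product with \<open>e p\<close>. A step
  from \<open>p\<close> towards a neighbour at \<open>q\<close> has at most the product \<open>e p \<bullet> (e q - e p)\<close>, and on the
  stacked deviations the Laplacian flow is dissipative by weight balance. Hence the sum of the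
  squared distances never increases.
\<close>

lemma feasible_set_invariant:
  fixes X V :: "real \<Rightarrow> 'a::euclidean_space^'v" and \<Omega> :: "'a set"
  assumes \<Omega>: "convex \<Omega>" "compact \<Omega>"
    and graph: "adjacency_matrix E A" "weight_balanced A"
    and \<beta>: "\<And>t. t \<ge> 0 \<Longrightarrow> \<beta> t \<ge> 0" "\<And>t. t \<ge> 0 \<Longrightarrow> \<beta> integrable_on {0..t}"
    and X: "continuous_on {0..} X"
    and flow: "\<And>a b. 0 \<le> a \<Longrightarrow> a \<le> b \<Longrightarrow>
      ((\<lambda>\<tau>. laplacian_flow A (X \<tau>) + \<beta> \<tau> *\<^sub>R (V \<tau> - X \<tau>)) has_integral (X b - X a)) {a..b}"
    and V: "\<And>t i. t \<ge> 0 \<Longrightarrow> V t $ i \<in> \<Omega>"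
    and X0: "\<And>i. X 0 $ i \<in> \<Omega>"
    and t: "t \<ge> 0"
  shows "X t $ i \<in> \<Omega>"
proof -
  have closed: "closed \<Omega>" and ne: "\<Omega> \<noteq> {}" using \<Omega> X0 compact_imp_closed by auto
  define e where "e p = p - closest_point \<Omega> p" for p
  define dev where "dev U = (\<chi> i. e (U $ i))" for U :: "'a^'v"
  define w where "w \<tau> = laplacian_flow A (X \<tau>) + \<beta> \<tau> *\<^sub>R (V \<tau> - X \<tau>)" for \<tau>
  have cont_dev: "continuous_on {0..t} (\<lambda>\<tau>. dev (X \<tau>))"
  proof -
    have "continuous_on {0..t} X" using X by (rule continuous_on_subset) auto
    then show ?thesis unfolding dev_def e_def
      by (intro continuous_intros
          continuous_on_compose2[OF continuous_on_closest_point[OF \<Omega>(1) closed ne, of UNIV]]) auto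
  qed
  have upper: "(norm (dev q))\<^sup>2 \<le> (norm (dev p))\<^sup>2 + (2 *\<^sub>R dev p) \<bullet> (q - p) + 1 * (norm (q - p))\<^sup>2" for p q
  proof -
    have "norm (dev q) \<le> norm (dev p + (q - p))"
    proof (rule norm_le_componentwise_cart)
      fix i
      have "norm (e (q $ i)) \<le> norm (q $ i - closest_point \<Omega> (p $ i))"
        using closest_point_le[OF closed closest_point_in_set[OF closed ne]] by (simp add: e_def dist_norm)
      then show "norm (dev q $ i) \<le> norm ((dev p + (q - p)) $ i)" by (simp add: dev_def e_def)
    qed
    then have "(norm (dev q))\<^sup>2 \<le> (norm (dev p + (q - p)))\<^sup>2" by (intro power_mono) auto
    then show ?thesis by (simp add: power2_norm_eq_inner inner_add inner_commute)
  qed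
  have toward: "e p \<bullet> (q - p) \<le> e p \<bullet> (e q - e p)" for p q
    using closest_point_dot[OF \<Omega>(1) closed closest_point_in_set[OF closed ne], of p q]
    by (simp add: e_def inner_diff_right inner_diff_left)
  have inward: "e p \<bullet> (q - p) \<le> 0" if "q \<in> \<Omega>" for p q
  proof -
    have "e q = 0" using that by (simp add: e_def closest_point_self)
    then have "e p \<bullet> (e q - e p) = - (e p \<bullet> e p)" by simp
    with toward[of p q] show ?thesis using inner_ge_zero[of "e p"] by linarith
  qed
  have slope: "(2 *\<^sub>R dev (X \<tau>)) \<bullet> w \<tau> \<le> - 0" if "\<tau> \<in> {0..t}" for \<tau>
  proof -
    have "dev (X \<tau>) \<bullet> laplacian_flow A (X \<tau>) \<le> dev (X \<tau>) \<bullet> laplacian_flow A (dev (X \<tau>))"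
      unfolding inner_vec_def laplacian_flow_def
      by (auto simp: inner_sum_right dev_def adjacency_matrix_nonneg[OF graph(1)]
          intro!: sum_mono mult_left_mono toward)
    also have "\<dots> \<le> 0"
      unfolding inner_laplacian_flow[OF graph(2)]
      by (auto intro!: sum_nonneg mult_nonneg_nonneg adjacency_matrix_nonneg[OF graph(1)])
    finally have "dev (X \<tau>) \<bullet> laplacian_flow A (X \<tau>) \<le> 0" .
    moreover have "dev (X \<tau>) \<bullet> (V \<tau> - X \<tau>) \<le> 0"
      unfolding inner_vec_def using that V by (auto simp: dev_def intro!: sum_nonpos inward)
    then have "\<beta> \<tau> * (dev (X \<tau>) \<bullet> (V \<tau> - X \<tau>)) \<le> 0"
      using \<beta>(1) that by (auto simp: mult_nonneg_nonpos)
    ultimately show ?thesis by (simp add: w_def inner_add_right)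
  qed
  have contX: "continuous_on {0..t} X" using X by (rule continuous_on_subset) auto
  obtain K1 where K1: "\<And>\<tau>. \<tau> \<in> {0..t} \<Longrightarrow> norm (laplacian_flow A (X \<tau>)) \<le> K1"
  proof -
    have "continuous_on {0..t} (\<lambda>\<tau>. laplacian_flow A (X \<tau>))"
      by (rule bounded_linear.continuous_on[OF bounded_linear_laplacian_flow contX])
    then have "bounded ((\<lambda>\<tau>. laplacian_flow A (X \<tau>)) ` {0..t})"
      by (intro compact_imp_bounded compact_continuous_image) auto
    then show thesis using that unfolding bounded_iff by blast
  qed
  obtain K2 where K2: "\<And>\<tau>. \<tau> \<in> {0..t} \<Longrightarrow> norm (X \<tau>) \<le> K2"
    using compact_imp_bounded[OF compact_continuous_image[OF contX]] unfolding bounded_iff by blast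
  obtain K3 where K3: "\<And>p. p \<in> \<Omega> \<Longrightarrow> norm p \<le> K3"
    using compact_imp_bounded[OF \<Omega>(2)] unfolding bounded_iff by blast
  let ?K = "real CARD('v) * K3 + K2"
  have w_le: "norm (w \<tau>) \<le> K1 + \<beta> \<tau> * ?K" if "\<tau> \<in> {0..t}" for \<tau>
  proof -
    have "norm (V \<tau>) \<le> real CARD('v) * K3"
      using V that by (intro norm_vec_le_card K3) auto
    then have "norm (V \<tau> - X \<tau>) \<le> ?K"
      using K2[OF that] norm_triangle_ineq4[of "V \<tau>" "X \<tau>"] by linarith
    then have "norm (\<beta> \<tau> *\<^sub>R (V \<tau> - X \<tau>)) \<le> \<beta> \<tau> * ?K"
      using \<beta>(1) that by (auto intro: mult_left_mono)
    then show ?thesis using K1[OF that] norm_triangle_ineq[of "laplacian_flow A (X \<tau>)" "\<beta> \<tau> *\<^sub>R (V \<tau> - X \<tau>)"]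
      unfolding w_def by linarith
  qed
  have flow_w: "(w has_integral (X b - X a)) {a..b}" if "0 \<le> a" "a \<le> b" for a b
  proof -
    have "w = (\<lambda>\<tau>. laplacian_flow A (X \<tau>) + \<beta> \<tau> *\<^sub>R (V \<tau> - X \<tau>))"
      by (rule ext) (rule w_def)
    then show ?thesis using flow[OF that] by (simp only:)
  qed
  have cont_G: "continuous_on {0..t} (\<lambda>\<tau>. 2 *\<^sub>R dev (X \<tau>))"
    using cont_dev by (rule continuous_on_scaleR[OF continuous_on_const])
  have \<rho>: "(\<lambda>\<tau>. K1 + \<beta> \<tau> * ?K) integrable_on {0..t}"
    using integrable_add[OF integrable_const_ivl integrable_on_mult_left[OF \<beta>(2)[OF t]]] .
  have "(norm (dev (X t)))\<^sup>2 \<le> (norm (dev (X 0)))\<^sup>2 - integral {0..t} (\<lambda>_. 0)"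
    using descent_along_integral_curve[where u = X and w = w and S = UNIV and C = 1 and
        \<phi> = "\<lambda>U. (norm (dev U))\<^sup>2" and G = "\<lambda>U. 2 *\<^sub>R dev U" and
        \<rho> = "\<lambda>\<tau>. K1 + \<beta> \<tau> * ?K" and m = "\<lambda>_. 0",
        OF t zero_le_one upper UNIV_I cont_G flow_w w_le \<rho> integrable_0 slope] .
  moreover have "dev (X 0) = 0"
    using X0 by (simp add: dev_def e_def vec_eq_iff closest_point_self)
  ultimately have "dev (X t) = 0" by simp
  then have "closest_point \<Omega> (X t $ i) = X t $ i"
    by (simp add: dev_def e_def vec_eq_iff)
  then show ?thesis using closest_point_in_set[OF closed ne] by metis
qed

section \<open>Frank-Wolfe with an asymptotically exact gradients\<close>

text \<open>
  The one-dimensional tangent inequality on the line through \<open>p\<close> and \<open>q\<close>.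
\<close>

lemma convex_on_gradient_below:
  fixes f :: "'a::euclidean_space \<Rightarrow> real"
  assumes convex: "convex_on UNIV f" and diff: "f differentiable (at p)"
  shows "f p + gradient f p \<bullet> (q - p) \<le> f q"
proof -
  let ?g = "\<lambda>h::real. f (p + h *\<^sub>R (q - p))"
  have "convex_on UNIV ?g"
  proof (rule convex_onI)
    fix t a b :: real assume t: "0 < t" "t < 1"
    have "p + ((1 - t) *\<^sub>R a + t *\<^sub>R b) *\<^sub>R (q - p) =
        (1 - t) *\<^sub>R (p + a *\<^sub>R (q - p)) + t *\<^sub>R (p + b *\<^sub>R (q - p))"
      by (simp add: algebra_simps)
    then show "?g ((1 - t) *\<^sub>R a + t *\<^sub>R b) \<le> (1 - t) * ?g a + t * ?g b"
      using convex_onD[OF convex, of t "p + a *\<^sub>R (q - p)" "p + b *\<^sub>R (q - p)"] t by simp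
  qed simp
  moreover have "(?g has_field_derivative (gradient f p \<bullet> (q - p))) (at 0 within UNIV)"
  proof -
    have "((\<lambda>h::real. p + h *\<^sub>R (q - p)) has_derivative (\<lambda>h. h *\<^sub>R (q - p))) (at 0)"
      by (auto intro!: derivative_eq_intros)
    moreover have "(f has_derivative (\<lambda>h. h \<bullet> gradient f p)) (at (p + 0 *\<^sub>R (q - p)))"
      using GDERIV_gradient[OF diff] by (simp add: gderiv_def)
    ultimately have "(?g has_derivative (\<lambda>h. (h *\<^sub>R (q - p)) \<bullet> gradient f p)) (at 0)"
      by (rule has_derivative_compose)
    moreover have "(\<lambda>h. (h *\<^sub>R (q - p)) \<bullet> gradient f p) = (*) (gradient f p \<bullet> (q - p))"
      by (auto simp: inner_commute)
    ultimately show ?thesis by (simp add: has_field_derivative_def)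
  qed
  ultimately show ?thesis
    using convex_on_imp_above_tangent[of UNIV ?g 0 1 "gradient f p \<bullet> (q - p)"] by simp
qed

text \<open>
  While the optimality gap exceeds \<open>r\<close>, convexity gives \<open>g c \<bullet> (q - c) \<le> - r\<close>. A
  direction \<open>d\<close> that is optimal up to \<open>r / 2\<close> therefore still has \<open>g c \<bullet> (d - c) \<le> - r / 2\<close>, and the
  gap falls at rate \<open>r / 2 * \<beta>\<close>. The quadratic upper bound for \<open>F\<close> with constant \<open>\<kappa>\<close>
  follows from the tangent inequality at the end point of a step: it gives
  \<open>F q - F p \<le> g q \<bullet> (q - p)\<close>, and \<open>g q\<close> differs from \<open>g p\<close> by at most \<open>\<kappa> * norm (q - p)\<close>.
\<close>

lemma frank_wolfe_optimality:
  fixes c d :: "real \<Rightarrow> 'a::euclidean_space"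
  assumes \<Omega>: "compact \<Omega>" and F: "continuous_on \<Omega> F"
    and below: "\<And>p q. p \<in> \<Omega> \<Longrightarrow> q \<in> \<Omega> \<Longrightarrow> F p + g p \<bullet> (q - p) \<le> F q"
    and g: "\<kappa>-lipschitz_on \<Omega> g"
    and \<beta>_pos: "\<And>t. t \<ge> 0 \<Longrightarrow> \<beta> t > 0"
    and \<beta>_int: "\<And>t. t \<ge> 0 \<Longrightarrow> \<beta> integrable_on {0..t}"
    and \<beta>_div: "filterlim (\<lambda>t. integral {0..t} \<beta>) at_top at_top"
    and c: "continuous_on {0..} c" "\<And>t. t \<ge> 0 \<Longrightarrow> c t \<in> \<Omega>"
    and d: "\<And>t. t \<ge> 0 \<Longrightarrow> d t \<in> \<Omega>"
    and flow: "\<And>a b. 0 \<le> a \<Longrightarrow> a \<le> b \<Longrightarrow>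
      ((\<lambda>\<tau>. \<beta> \<tau> *\<^sub>R (d \<tau> - c \<tau>)) has_integral (c b - c a)) {a..b}"
    and exact: "\<And>\<delta>. \<delta> > 0 \<Longrightarrow> \<forall>\<^sub>F t in at_top. g (c t) \<bullet> d t \<le> g (c t) \<bullet> q + \<delta>"
    and q: "q \<in> \<Omega>" "\<And>p. p \<in> \<Omega> \<Longrightarrow> F q \<le> F p"
  shows "((\<lambda>t. F (c t)) \<longlongrightarrow> F q) at_top"
proof -
  have \<beta>_sub: "\<beta> integrable_on {a..b}" if "0 \<le> a" "a \<le> b" for a b
    using \<beta>_int[of b] that by (auto intro: integrable_on_subinterval)
  have \<kappa>: "\<kappa> \<ge> 0" using g by (rule lipschitz_on_nonneg)
  have upper: "F q \<le> F p + g p \<bullet> (q - p) + \<kappa> * (norm (q - p))\<^sup>2" if "p \<in> \<Omega>" "q \<in> \<Omega>" for p q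
  proof -
    have "F q \<le> F p + g q \<bullet> (q - p)"
      using below[OF that(2,1)] by (simp add: inner_diff_right)
    also have "\<dots> = F p + g p \<bullet> (q - p) + (g q - g p) \<bullet> (q - p)"
      by (simp add: inner_diff_left)
    also have "(g q - g p) \<bullet> (q - p) \<le> norm (g q - g p) * norm (q - p)"
      by (rule norm_cauchy_schwarz)
    also have "\<dots> \<le> \<kappa> * norm (q - p) * norm (q - p)"
      using lipschitz_onD[OF g that(2,1)] by (intro mult_right_mono) (auto simp: dist_norm)
    finally show ?thesis by (simp add: power2_eq_square mult.assoc)
  qed
  have small: "\<forall>\<^sub>F t in at_top. F (c t) - F q \<le> r" if r: "r > 0" for r
  proof -
    obtain T0 where T0: "\<And>t. t \<ge> T0 \<Longrightarrow> g (c t) \<bullet> d t \<le> g (c t) \<bullet> q + r / 2"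
      using exact[of "r / 2"] r unfolding eventually_at_top_linorder by auto
    define T where "T = max 0 T0"
    have T: "T \<ge> 0" by (simp add: T_def)
    have B_diff: "integral {0..b} \<beta> = integral {0..a} \<beta> + integral {a..b} \<beta>" if "0 \<le> a" "a \<le> b" for a b
      using Henstock_Kurzweil_Integration.integral_combine[of 0 a b \<beta>] \<beta>_int[of b] that by simp
    show ?thesis
    proof (rule eventually_le_if_decreasing_above[where T = T and B = "\<lambda>t. r / 2 * integral {0..t} \<beta>"])
      show "continuous_on {T..} (\<lambda>t. F (c t) - F q)"
        using c(2) T by (intro continuous_intros continuous_on_compose2[OF F]
            continuous_on_subset[OF c(1)]) auto
      show "0 \<le> F (c t) - F q" if "t \<ge> T" for t
        using q(2)[OF c(2)[of t]] that T by simp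
      have "integral {0..a} \<beta> \<le> integral {0..b} \<beta>" if "T \<le> a" "a \<le> b" for a b
      proof -
        have "0 \<le> integral {a..b} \<beta>"
          using that T \<beta>_pos by (intro integral_nonneg \<beta>_sub) (auto intro: less_imp_le)
        then show ?thesis using B_diff[of a b] that T by simp
      qed
      then show "mono_on {T..} (\<lambda>t. r / 2 * integral {0..t} \<beta>)"
        unfolding mono_on_def using r by (intro allI impI mult_left_mono) auto
      show "LIM t at_top. r / 2 * integral {0..t} \<beta> :> at_top"
        using r by (intro filterlim_tendsto_pos_mult_at_top[OF tendsto_const] \<beta>_div) auto
    next
      fix s t assume st: "T \<le> s" "s \<le> t" and above: "\<And>\<tau>. \<tau> \<in> {s..t} \<Longrightarrow> r \<le> F (c \<tau>) - F q"
      have "F (c t) \<le> F (c s) - integral {s..t} (\<lambda>\<tau>. r / 2 * \<beta> \<tau>)"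
      proof (rule descent_along_integral_curve[where S = \<Omega> and C = \<kappa> and G = g and
            w = "\<lambda>\<tau>. \<beta> \<tau> *\<^sub>R (d \<tau> - c \<tau>)" and \<rho> = "\<lambda>\<tau>. diameter \<Omega> * \<beta> \<tau>", OF st(2) \<kappa> upper])
        fix \<tau> assume \<tau>: "\<tau> \<in> {s..t}"
        then have \<tau>0: "\<tau> \<ge> 0" "\<tau> \<ge> T0" using st by (auto simp: T_def)
        show "c \<tau> \<in> \<Omega>" using c(2) \<tau>0 by simp
        have "norm (d \<tau> - c \<tau>) \<le> diameter \<Omega>"
          using diameter_bounded_bound[OF compact_imp_bounded[OF \<Omega>] d[OF \<tau>0(1)] c(2)[OF \<tau>0(1)]]
          by (simp add: dist_norm)
        then show "norm (\<beta> \<tau> *\<^sub>R (d \<tau> - c \<tau>)) \<le> diameter \<Omega> * \<beta> \<tau>"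
          using \<beta>_pos[OF \<tau>0(1)] by simp
        have "g (c \<tau>) \<bullet> (d \<tau> - c \<tau>) \<le> g (c \<tau>) \<bullet> (q - c \<tau>) + r / 2"
          using T0[OF \<tau>0(2)] by (simp add: inner_diff_right)
        also have "\<dots> \<le> F q - F (c \<tau>) + r / 2"
          using below[OF c(2)[OF \<tau>0(1)] q(1)] by simp
        also have "\<dots> \<le> - (r / 2)" using above[OF \<tau>] by simp
        finally have "\<beta> \<tau> * (g (c \<tau>) \<bullet> (d \<tau> - c \<tau>)) \<le> \<beta> \<tau> * - (r / 2)"
          using \<beta>_pos[OF \<tau>0(1)] by (intro mult_left_mono) auto
        then show "g (c \<tau>) \<bullet> \<beta> \<tau> *\<^sub>R (d \<tau> - c \<tau>) \<le> - (r / 2 * \<beta> \<tau>)" by (simp add: mult.commute)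
      next
        show "continuous_on {s..t} (\<lambda>\<tau>. g (c \<tau>))"
          using c(2) st T by (intro continuous_on_compose2[OF lipschitz_on_continuous_on[OF g]]
              continuous_on_subset[OF c(1)]) auto
        show "((\<lambda>\<tau>. \<beta> \<tau> *\<^sub>R (d \<tau> - c \<tau>)) has_integral (c b - c a)) {a..b}"
          if "s \<le> a" "a \<le> b" for a b
          using that st T by (intro flow) auto
        show "(\<lambda>\<tau>. diameter \<Omega> * \<beta> \<tau>) integrable_on {s..t}" "(\<lambda>\<tau>. r / 2 * \<beta> \<tau>) integrable_on {s..t}"
          using st T by (intro integrable_on_mult_right \<beta>_sub; simp)+
      qed
      then show "F (c t) - F q + r / 2 * integral {0..t} \<beta> \<le> F (c s) - F q + r / 2 * integral {0..s} \<beta>"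
        using B_diff[of s t] st T by (simp add: algebra_simps)
    qed
  qed
  show ?thesis
  proof (rule tendstoI)
    fix e :: real assume e: "e > 0"
    have "\<forall>\<^sub>F t in at_top. F (c t) - F q \<le> e / 2 \<and> t \<ge> 0"
      using small[of "e / 2"] e eventually_ge_at_top by (intro eventually_conj) auto
    then show "\<forall>\<^sub>F t in at_top. dist (F (c t)) (F q) < e"
    proof eventually_elim
      case (elim t)
      then show ?case using q(2)[OF c(2)[of t]] e by (simp add: dist_real_def)
    qed
  qed
qed

text \<open>
  On the compact set of points at distance at least \<open>e\<close> from the minimisers, \<open>F\<close> is bounded away
  from its minimum.
\<close>

lemma infdist_minimizers_tendsto_0:
  fixes \<Omega> :: "'a::metric_space set" and F :: "'a \<Rightarrow> real"
  assumes \<Omega>: "compact \<Omega>" and F: "continuous_on \<Omega> F"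
    and min: "\<And>p. p \<in> \<Omega> \<Longrightarrow> m \<le> F p"
    and c: "\<forall>\<^sub>F t in L. c t \<in> \<Omega>" "((\<lambda>t. F (c t)) \<longlongrightarrow> m) L"
  shows "((\<lambda>t. infdist (c t) {p \<in> \<Omega>. F p = m}) \<longlongrightarrow> 0) L"
proof (rule tendstoI)
  fix e :: real assume e: "e > 0"
  let ?M = "{p \<in> \<Omega>. F p = m}"
  let ?K = "\<Omega> \<inter> {p. e \<le> infdist p ?M}"
  have "closed {p. e \<le> infdist p ?M}" by (intro closed_Collect_le continuous_intros)
  with \<Omega> have K: "compact ?K" by (rule compact_Int_closed)
  show "\<forall>\<^sub>F t in L. dist (infdist (c t) ?M) 0 < e"
  proof (cases "?K = {}")
    case True
    from c(1) show ?thesis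
    proof eventually_elim
      case (elim t)
      with True show ?case by (auto simp: infdist_nonneg not_le)
    qed
  next
    case False
    then obtain k where k: "k \<in> ?K" "\<And>p. p \<in> ?K \<Longrightarrow> F k \<le> F p"
      using continuous_attains_inf[OF K False continuous_on_subset[OF F]] by blast
    have "F k \<noteq> m"
    proof
      assume "F k = m"
      then have "infdist k ?M = 0" using k(1) by (intro infdist_zero) auto
      then show False using k(1) e by simp
    qed
    then have "m < F k" using min[of k] k(1) by auto
    then have "\<forall>\<^sub>F t in L. F (c t) < F k" using c(2) by (rule order_tendstoD(2)[rotated])
    with c(1) show ?thesis
    proof eventually_elim
      case (elim t)
      then have "c t \<notin> ?K" using k(2)[of "c t"] by linarith
      with elim show ?case by (auto simp: infdist_nonneg not_le)
    qed
  qed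
qed

section \<open>Integrated differential equations\<close>

lemma solves_ode_integrated_has_integral:
  assumes "solves_ode_integrated u w" "0 \<le> a" "a \<le> b"
  shows "(w has_integral (u b - u a)) {a..b}"
proof -
  have w: "(w has_integral (u b - u 0)) {0..b}" "(w has_integral (u a - u 0)) {0..a}"
    using assms by (auto simp: solves_ode_integrated_def)
  then have "w integrable_on {0..b}" by blast
  then have "w integrable_on {a..b}" using assms(2) by (auto intro: integrable_on_subinterval)
  moreover have "integral {a..b} w = u b - u a"
    using integral_diff_initial[OF \<open>w integrable_on {0..b}\<close> assms(2,3) order_refl] w
    by (simp add: integral_unique)
  ultimately show ?thesis by (simp add: has_integral_iff)
qed

lemma solves_ode_integrated_continuous_on:
  assumes "solves_ode_integrated u w"
  shows "continuous_on {0..} u"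
  unfolding continuous_on_eq_continuous_within
proof
  fix t :: real assume t: "t \<in> {0..}"
  have w: "(w has_integral (u \<tau> - u 0)) {0..\<tau>}" if "\<tau> \<ge> 0" for \<tau>
    using assms that by (simp add: solves_ode_integrated_def)
  from has_integral_integrable[OF this, of "t + 1"] have "w integrable_on {0..t + 1}"
    using t by simp
  then have "continuous_on {0..t + 1} (\<lambda>\<tau>. u 0 + integral {0..\<tau>} w)"
    by (intro continuous_intros indefinite_integral_continuous_1)
  then have "continuous_on {0..t + 1} u"
    by (rule continuous_on_eq) (simp add: integral_unique[OF w])
  then have "continuous (at t within {0..t + 1}) u"
    using t by (simp add: continuous_on_eq_continuous_within)
  moreover have "at t within {0..t + 1} = at t within {0..}"
    by (rule at_within_nhd[of t "{..<t + 1}"]) auto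
  ultimately show "continuous (at t within {0..}) u" by simp
qed

text \<open>
  A family of vector-valued integrals is one integral of the stacked vector, which lets the whole
  network be treated as a single trajectory.
\<close>

lemma has_integral_vec:
  fixes w :: "'b::euclidean_space \<Rightarrow> 'a::euclidean_space^'v"
  assumes "\<And>i. ((\<lambda>\<tau>. w \<tau> $ i) has_integral (I $ i)) S"
  shows "(w has_integral I) S"
  unfolding has_integral_componentwise_iff[of w]
proof
  fix b :: "'a^'v" assume "b \<in> Basis"
  then obtain i k where b: "b = axis i k" by (auto simp: Basis_vec_def)
  show "((\<lambda>x. w x \<bullet> b) has_integral I \<bullet> b) S"
    using has_integral_linear[OF assms[of i] bounded_linear_inner_left[of k]]
    by (simp add: b inner_axis o_def)
qed

section \<open>Convergence of the distributed Frank-Wolfe dynamics\<close>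

theorem theorem1:
  fixes \<Omega> :: "(real^'n) set"
    and f :: "'v::finite \<Rightarrow> real^'n \<Rightarrow> real"
    and E :: "('v \<times> 'v) set"
    and A :: "real^'v^'v"
    and \<kappa> :: real
    and \<beta> :: "real \<Rightarrow> real"
    and x y z v :: "'v \<Rightarrow> real \<Rightarrow> real^'n"
  assumes Omega: "convex \<Omega>" "compact \<Omega>" "\<Omega> \<noteq> {}"
    and f_convex: "\<And>i. convex_on UNIV (f i)"
    and f_differentiable: "\<And>i p. f i differentiable (at p)"
    and kappa: "\<kappa> > 0"
    and f_gradient: "\<And>i. lipschitz_on \<kappa> \<Omega> (gradient (f i))"
    and graph: "adjacency_matrix E A" "strongly_connected E" "weight_balanced A"
    and beta_pos: "\<And>t. t \<ge> 0 \<Longrightarrow> \<beta> t > 0"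
    and beta_lim: "(\<beta> \<longlongrightarrow> 0) at_top"
    and beta_integrable: "\<And>t. t \<ge> 0 \<Longrightarrow> \<beta> integrable_on {0..t}"
    and beta_diverges: "filterlim (\<lambda>t. integral {0..t} \<beta>) at_top at_top"
    and x_dynamics: "\<And>i. solves_ode_integrated (x i)
          (\<lambda>t. (\<Sum>j\<in>UNIV. A $ i $ j *\<^sub>R (x j t - x i t)) + \<beta> t *\<^sub>R (v i t - x i t))"
    and v_argmin: "\<And>i t. t > 0 \<Longrightarrow> is_arg_min (\<lambda>w. inner (z i t) w) (\<lambda>w. w \<in> \<Omega>) (v i t)"
    and y_dynamics: "\<And>i. solves_ode_integrated (y i)
          (\<lambda>t. \<Sum>j\<in>UNIV. A $ i $ j *\<^sub>R (z j t - z i t))"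
    and z_eq: "\<And>i t. t > 0 \<Longrightarrow> z i t = y i t + gradient (f i) (x i t)"
    and initial: "\<And>i. x i 0 \<in> \<Omega>" "\<And>i. y i 0 = 0" "\<And>i. v i 0 \<in> \<Omega>"
  shows "(\<forall>i j. ((\<lambda>t. x i t - x j t) \<longlongrightarrow> 0) at_top)
    \<and> (\<forall>i. ((\<lambda>t. z i t - (1 / real CARD('v)) *\<^sub>R (\<Sum>j\<in>UNIV. gradient (f j) (x j t))) \<longlongrightarrow> 0) at_top)
    \<and> converge_to_common_optimum f \<Omega> x
    \<and> (\<forall>p. optimal_solutions f \<Omega> = {p} \<longrightarrow> (\<forall>i. (x i \<longlongrightarrow> p) at_top))"
proof -
  define X V Y Z where "X t = (\<chi> i. x i t)" and "V t = (\<chi> i. v i t)" and "Y t = (\<chi> i. y i t)"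
    and "Z t = (\<chi> i. z i t)" for t
  define grads where "grads t = (\<chi> i. gradient (f i) (x i t))" for t
  define F where "F = global_cost f"
  define gF where "gF p = average (\<chi> i. gradient (f i) p)" for p

  have v_in: "v i t \<in> \<Omega>" if "t \<ge> 0" for i t
    using initial(3) v_argmin[of t i] that unfolding is_arg_min_def by (cases "t = 0") auto
  have X_flow: "((\<lambda>\<tau>. laplacian_flow A (X \<tau>) + \<beta> \<tau> *\<^sub>R (V \<tau> - X \<tau>)) has_integral (X b - X a)) {a..b}"
    if "0 \<le> a" "a \<le> b" for a b
  proof (rule has_integral_vec)
    fix i show "((\<lambda>\<tau>. (laplacian_flow A (X \<tau>) + \<beta> \<tau> *\<^sub>R (V \<tau> - X \<tau>)) $ i) has_integral (X b - X a) $ i) {a..b}"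
      using solves_ode_integrated_has_integral[OF x_dynamics that, of i]
      by (simp add: laplacian_flow_def X_def V_def)
  qed
  have Y_flow: "((\<lambda>\<tau>. laplacian_flow A (Z \<tau>)) has_integral (Y b - Y a)) {a..b}"
    if "0 \<le> a" "a \<le> b" for a b
  proof (rule has_integral_vec)
    fix i show "((\<lambda>\<tau>. laplacian_flow A (Z \<tau>) $ i) has_integral (Y b - Y a) $ i) {a..b}"
      using solves_ode_integrated_has_integral[OF y_dynamics that, of i]
      by (simp add: laplacian_flow_def Y_def Z_def)
  qed
  have X_cont: "continuous_on {0..} X"
    unfolding X_def by (intro continuous_on_vec_lambda solves_ode_integrated_continuous_on[OF x_dynamics])
  have Y_cont: "continuous_on {0..} Y"
    unfolding Y_def by (intro continuous_on_vec_lambda solves_ode_integrated_continuous_on[OF y_dynamics])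
  have x_in: "x i t \<in> \<Omega>" if "t \<ge> 0" for i t
    using feasible_set_invariant[OF Omega(1,2) graph(1,3) less_imp_le[OF beta_pos] beta_integrable
        X_cont X_flow _ _ that, of i] v_in initial(1) by (simp add: V_def X_def)
  have lap_X_int: "(\<lambda>\<tau>. laplacian_flow A (X \<tau>)) integrable_on {a..b}" if "0 \<le> a" for a b
    using that by (intro integrable_continuous_real
        bounded_linear.continuous_on[OF bounded_linear_laplacian_flow] continuous_on_subset[OF X_cont]) auto

  \<comment> \<open>Consensus: the Frank-Wolfe term is a slow perturbation of the Laplacian flow.\<close>
  define R where "R t = integral {0..t} (\<lambda>\<tau>. \<beta> \<tau> *\<^sub>R (V \<tau> - X \<tau>))" for t
  have fw_int: "(\<lambda>\<tau>. \<beta> \<tau> *\<^sub>R (V \<tau> - X \<tau>)) integrable_on {a..b}" if "0 \<le> a" "a \<le> b" for a b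
    using integrable_diff[OF has_integral_integrable[OF X_flow[OF that]] lap_X_int[OF that(1)]] by simp
  have R_diff: "R b - R a = integral {a..b} (\<lambda>\<tau>. \<beta> \<tau> *\<^sub>R (V \<tau> - X \<tau>))" if "0 \<le> a" "a \<le> b" for a b
    using integral_diff_initial[OF fw_int[of 0 b], of a b] that by (simp add: R_def)
  have X_diff: "X b - X a = integral {a..b} (\<lambda>\<tau>. laplacian_flow A (X \<tau>)) + (R b - R a)"
    if "0 \<le> a" "a \<le> b" for a b
    using integral_add[OF lap_X_int fw_int] integral_unique[OF X_flow] R_diff that by simp
  define D where "D = real CARD('v) * diameter \<Omega>"
  have D: "D \<ge> 0" using diameter_ge_0[OF compact_imp_bounded[OF Omega(2)]] by (simp add: D_def)
  have R_slow: "\<exists>T. \<forall>a b. T \<le> a \<longrightarrow> a \<le> b \<longrightarrow> norm (R b - R a) \<le> \<epsilon> * (b - a)" if \<epsilon>: "\<epsilon> > 0" for \<epsilon>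
  proof -
    \<comment> \<open>The summand 1 covers the case that \<open>\<Omega>\<close> is a single point, where \<open>D = 0\<close>.\<close>
    have "\<forall>\<^sub>F t in at_top. \<beta> t < \<epsilon> / (D + 1)"
      using D \<epsilon> by (intro order_tendstoD(2)[OF beta_lim]) auto
    then obtain T0 where T0: "\<And>t. t \<ge> T0 \<Longrightarrow> \<beta> t < \<epsilon> / (D + 1)"
      unfolding eventually_at_top_linorder by blast
    have "norm (R b - R a) \<le> \<epsilon> * (b - a)" if ab: "max 0 T0 \<le> a" "a \<le> b" for a b
    proof -
      have "norm (\<beta> \<tau> *\<^sub>R (V \<tau> - X \<tau>)) \<le> \<epsilon>" if "\<tau> \<in> {a..b}" for \<tau>
      proof -
        have \<tau>: "\<tau> \<ge> 0" "\<tau> \<ge> T0" using that ab by auto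
        have "norm (V \<tau> - X \<tau>) \<le> D" unfolding D_def
          using diameter_bounded_bound[OF compact_imp_bounded[OF Omega(2)] v_in[OF \<tau>(1)] x_in[OF \<tau>(1)]]
          by (intro norm_vec_le_card) (simp add: V_def X_def dist_norm)
        then have "\<beta> \<tau> * norm (V \<tau> - X \<tau>) \<le> \<epsilon> / (D + 1) * D"
          using T0[OF \<tau>(2)] beta_pos[OF \<tau>(1)] D \<epsilon> by (intro mult_mono) auto
        also have "\<dots> \<le> \<epsilon>" using D \<epsilon> by (simp add: field_simps)
        finally show ?thesis using beta_pos[OF \<tau>(1)] by simp
      qed
      then have "norm (integral {a..b} (\<lambda>\<tau>. \<beta> \<tau> *\<^sub>R (V \<tau> - X \<tau>))) \<le> integral {a..b} (\<lambda>_. \<epsilon>)"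
        using ab by (intro integral_norm_bound_integral fw_int) auto
      then show ?thesis using ab by (simp add: R_diff mult.commute)
    qed
    then show ?thesis by blast
  qed
  have X_consensus: "((\<lambda>t. disagreement (X t)) \<longlongrightarrow> 0) at_top"
    by (rule perturbed_consensus[OF graph X_cont X_diff R_slow])

  \<comment> \<open>Tracking: after consensus both parts of the velocity of \<open>X\<close> are small, so the gradients are slow.\<close>
  have lap_X_lim: "((\<lambda>t. laplacian_flow A (X t)) \<longlongrightarrow> 0) at_top"
    using bounded_linear.tendsto_zero[OF bounded_linear_laplacian_flow X_consensus, of A]
    by (simp add: laplacian_flow_disagreement)
  have grads_slow: "\<exists>T. \<forall>a b. T \<le> a \<longrightarrow> a \<le> b \<longrightarrow> norm (grads b - grads a) \<le> \<epsilon> * (b - a)"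
    if \<epsilon>: "\<epsilon> > 0" for \<epsilon>
  proof -
    define L where "L = real CARD('v) * \<kappa>"
    define \<epsilon>' where "\<epsilon>' = \<epsilon> / (2 * L)"
    have L: "L > 0" using kappa by (simp add: L_def)
    have \<epsilon>': "\<epsilon>' > 0" using \<epsilon> L by (simp add: \<epsilon>'_def)
    obtain T1 where T1: "\<And>a b. T1 \<le> a \<Longrightarrow> a \<le> b \<Longrightarrow> norm (R b - R a) \<le> \<epsilon>' * (b - a)"
      using R_slow[OF \<epsilon>'] by blast
    have "\<forall>\<^sub>F t in at_top. norm (laplacian_flow A (X t)) < \<epsilon>'"
      using tendstoD[OF lap_X_lim \<epsilon>'] by simp
    then obtain T2 where T2: "\<And>t. t \<ge> T2 \<Longrightarrow> norm (laplacian_flow A (X t)) < \<epsilon>'"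
      unfolding eventually_at_top_linorder by blast
    have "norm (grads b - grads a) \<le> \<epsilon> * (b - a)" if ab: "max 0 (max T1 T2) \<le> a" "a \<le> b" for a b
    proof -
      have "norm (integral {a..b} (\<lambda>\<tau>. laplacian_flow A (X \<tau>))) \<le> integral {a..b} (\<lambda>_. \<epsilon>')"
        using ab T2 by (intro integral_norm_bound_integral lap_X_int) (auto intro: less_imp_le)
      then have "norm (integral {a..b} (\<lambda>\<tau>. laplacian_flow A (X \<tau>))) \<le> \<epsilon>' * (b - a)"
        using ab by (simp add: mult.commute)
      moreover have "norm (R b - R a) \<le> \<epsilon>' * (b - a)" using T1 ab by simp
      moreover have "X b - X a = integral {a..b} (\<lambda>\<tau>. laplacian_flow A (X \<tau>)) + (R b - R a)"
        using X_diff ab by simp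
      ultimately have X_le: "norm (X b - X a) \<le> 2 * \<epsilon>' * (b - a)"
        using norm_triangle_ineq[of "integral {a..b} (\<lambda>\<tau>. laplacian_flow A (X \<tau>))" "R b - R a"] by simp
      have "norm ((grads b - grads a) $ i) \<le> \<kappa> * norm (X b - X a)" for i
      proof -
        have "norm ((grads b - grads a) $ i) \<le> \<kappa> * norm (x i b - x i a)"
          using lipschitz_onD[OF f_gradient[of i] x_in[of b i] x_in[of a i]] ab by (simp add: grads_def dist_norm)
        also have "\<dots> \<le> \<kappa> * norm (X b - X a)"
          using Finite_Cartesian_Product.norm_nth_le[of "X b - X a" i] kappa by (intro mult_left_mono) (auto simp: X_def)
        finally show ?thesis .
      qed
      then have "norm (grads b - grads a) \<le> L * norm (X b - X a)"
        unfolding L_def mult.assoc by (rule norm_vec_le_card)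
      also have "\<dots> \<le> L * (2 * \<epsilon>' * (b - a))" using X_le L by (intro mult_left_mono) auto
      also have "\<dots> = \<epsilon> * (b - a)" using L by (simp add: \<epsilon>'_def)
      finally show ?thesis .
    qed
    then show ?thesis by blast
  qed
  have Z_eq: "Z t = Y t + grads t" if "t > 0" for t
    using z_eq[OF that] by (simp add: Z_def Y_def grads_def vec_eq_iff)
  have grads_cont: "continuous_on {0..} grads"
    unfolding grads_def
    by (intro continuous_on_vec_lambda continuous_on_compose2[OF lipschitz_on_continuous_on[OF f_gradient]]
        solves_ode_integrated_continuous_on[OF x_dynamics]) (auto intro: x_in)
  \<comment> \<open>The value of \<open>z\<close> at time 0 is arbitrary, so \<open>Z\<close> is considered from time 1 on only.\<close>
  have Z_cont: "continuous_on {1..} Z"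
  proof (rule continuous_on_eq)
    show "continuous_on {1..} (\<lambda>t. Y t + grads t)"
      by (intro continuous_on_add continuous_on_subset[OF Y_cont] continuous_on_subset[OF grads_cont]) auto
  qed (auto simp: Z_eq)
  have Z_diff: "Z b - Z a = integral {a..b} (\<lambda>\<tau>. laplacian_flow A (Z \<tau>)) + (grads b - grads a)"
    if "1 \<le> a" "a \<le> b" for a b
    using integral_unique[OF Y_flow, of a b] that by (simp add: Z_eq)
  have Z_consensus: "((\<lambda>t. disagreement (Z t)) \<longlongrightarrow> 0) at_top"
    by (rule perturbed_consensus[OF graph Z_cont Z_diff grads_slow])
  have average_Y: "average (Y t) = 0" if "t \<ge> 0" for t
  proof -
    have "((\<lambda>\<tau>. average (laplacian_flow A (Z \<tau>))) has_integral average (Y t - Y 0)) {0..t}"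
      using has_integral_linear[OF Y_flow bounded_linear_average] that by (simp add: o_def)
    then have "((\<lambda>\<tau>. 0) has_integral average (Y t - Y 0)) {0..t}"
      by (simp only: average_laplacian_flow[OF graph(3)])
    then have "average (Y t - Y 0) = 0" using has_integral_0_eq by blast
    moreover have "Y 0 = 0" using initial(2) by (simp add: Y_def vec_eq_iff)
    ultimately show ?thesis by simp
  qed
  have tracking: "((\<lambda>t. z i t - average (grads t)) \<longlongrightarrow> 0) at_top" for i
  proof (rule Lim_transform_eventually)
    show "((\<lambda>t. disagreement (Z t) $ i) \<longlongrightarrow> 0) at_top"
      using tendsto_vec_nth[OF Z_consensus, of i] by simp
    have "disagreement (Z t) $ i = z i t - average (grads t)" if "t > 0" for t
    proof -
      have "average (Z t) = average (grads t)"
        using that average_Y[of t] by (simp add: Z_eq linear_add[OF linear_average])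
      then show ?thesis by (simp add: disagreement_def Z_def)
    qed
    then show "\<forall>\<^sub>F t in at_top. disagreement (Z t) $ i = z i t - average (grads t)"
      by (rule eventually_mono[OF eventually_gt_at_top])
  qed

  \<comment> \<open>Optimality: the average follows a Frank-Wolfe flow for \<open>F\<close>.\<close>
  define c where "c t = average (X t)" for t
  have x_c: "((\<lambda>t. x i t - c t) \<longlongrightarrow> 0) at_top" for i
    using tendsto_vec_nth[OF X_consensus, of i] by (simp add: disagreement_def c_def X_def)
  have c_in: "c t \<in> \<Omega>" if "t \<ge> 0" for t
    unfolding c_def using x_in that by (intro average_in_convex Omega(1)) (simp add: X_def)
  have gF_lipschitz: "\<kappa>-lipschitz_on \<Omega> gF"
  proof (rule lipschitz_onI)
    fix p q assume "p \<in> \<Omega>" "q \<in> \<Omega>"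
    then have "norm (average ((\<chi> i. gradient (f i) p) - (\<chi> i. gradient (f i) q))) \<le> \<kappa> * dist p q"
      using lipschitz_onD[OF f_gradient] by (intro norm_average_le) (simp add: dist_norm)
    then show "dist (gF p) (gF q) \<le> \<kappa> * dist p q"
      by (simp add: gF_def dist_norm linear_diff[OF linear_average])
  qed (use kappa in simp)
  have F_below: "F p + gF p \<bullet> (q - p) \<le> F q" for p q
  proof -
    have "F p + gF p \<bullet> (q - p) = 1 / real CARD('v) * (\<Sum>i\<in>UNIV. f i p + gradient (f i) p \<bullet> (q - p))"
      unfolding sum.distrib distrib_left
      by (simp add: F_def global_cost_def gF_def average_def inner_sum_left)
    also have "\<dots> \<le> F q"
      unfolding F_def global_cost_def
      by (intro mult_left_mono sum_mono convex_on_gradient_below f_convex f_differentiable) auto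
    finally show ?thesis .
  qed
  have F_cont: "continuous_on \<Omega> F"
    unfolding F_def global_cost_def
    using differentiable_imp_continuous_within[OF f_differentiable]
    by (intro continuous_intros continuous_at_imp_continuous_on) auto
  obtain q where q: "q \<in> \<Omega>" "\<And>p. p \<in> \<Omega> \<Longrightarrow> F q \<le> F p"
    using continuous_attains_inf[OF Omega(2,3) F_cont] by blast
  have optimal: "optimal_solutions f \<Omega> = {p \<in> \<Omega>. F p = F q}"
  proof (intro equalityI subsetI)
    fix p assume "p \<in> optimal_solutions f \<Omega>"
    then have "p \<in> \<Omega>" "\<not> F q < F p"
      using q(1) by (auto simp: optimal_solutions_def is_arg_min_def F_def)
    then show "p \<in> {p \<in> \<Omega>. F p = F q}" using q(2)[of p] by simp
  next
    fix p assume "p \<in> {p \<in> \<Omega>. F p = F q}"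
    then have "p \<in> \<Omega>" "\<And>p'. p' \<in> \<Omega> \<Longrightarrow> F p \<le> F p'" using q(2) by auto
    then show "p \<in> optimal_solutions f \<Omega>"
      by (auto simp: optimal_solutions_def is_arg_min_def not_less simp flip: F_def)
  qed

  have z_gF: "((\<lambda>t. z i t - gF (c t)) \<longlongrightarrow> 0) at_top" for i
  proof -
    have "((\<lambda>t. average (grads t - (\<chi> i. gradient (f i) (c t)))) \<longlongrightarrow> 0) at_top"
    proof (rule bounded_linear.tendsto_zero[OF bounded_linear_average], rule vec_tendstoI)
      fix j
      show "((\<lambda>t. (grads t - (\<chi> i. gradient (f i) (c t))) $ j) \<longlongrightarrow> 0 $ j) at_top"
        unfolding zero_index
      proof (rule Lim_null_comparison)
        have "norm ((grads t - (\<chi> i. gradient (f i) (c t))) $ j) \<le> \<kappa> * norm (x j t - c t)" if "t \<ge> 0" for t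
          using lipschitz_onD[OF f_gradient[of j] x_in[OF that, of j] c_in[OF that]] by (simp add: grads_def dist_norm)
        then show "\<forall>\<^sub>F t in at_top. norm ((grads t - (\<chi> i. gradient (f i) (c t))) $ j) \<le> \<kappa> * norm (x j t - c t)"
          by (rule eventually_mono[OF eventually_ge_at_top])
        show "((\<lambda>t. \<kappa> * norm (x j t - c t)) \<longlongrightarrow> 0) at_top"
          by (intro tendsto_mult_right_zero tendsto_norm_zero x_c)
      qed
    qed
    then have "((\<lambda>t. average (grads t) - gF (c t)) \<longlongrightarrow> 0) at_top"
      by (simp add: linear_diff[OF linear_average] gF_def)
    from tendsto_add[OF tracking[of i] this] show ?thesis by simp
  qed
  have exact: "\<forall>\<^sub>F t in at_top. gF (c t) \<bullet> average (V t) \<le> gF (c t) \<bullet> q + \<delta>" if \<delta>: "\<delta> > 0" for \<delta>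
  proof -
    define r where "r = \<delta> / (diameter \<Omega> + 1)"
    have diam: "diameter \<Omega> \<ge> 0" by (intro diameter_ge_0 compact_imp_bounded Omega(2))
    have r: "r > 0" "r * diameter \<Omega> \<le> \<delta>" using \<delta> diam by (auto simp: r_def field_simps)
    have "\<forall>\<^sub>F t in at_top. \<forall>i. norm (z i t - gF (c t)) < r"
      using tendstoD[OF z_gF r(1)] by (intro eventually_all_finite) simp
    with eventually_gt_at_top[of 0] show ?thesis
    proof eventually_elim
      case (elim t)
      show ?case
      proof (rule inner_average_le)
        fix i
        have "z i t \<bullet> v i t \<le> z i t \<bullet> q"
          using v_argmin[of t i] q(1) elim(1) unfolding is_arg_min_def by (auto simp: not_less)
        moreover have "(z i t - gF (c t)) \<bullet> (q - v i t) \<le> norm (z i t - gF (c t)) * norm (q - v i t)"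
          by (rule norm_cauchy_schwarz)
        moreover have "\<dots> \<le> r * diameter \<Omega>"
          using elim v_in[of t i] diam r(1)
            diameter_bounded_bound[OF compact_imp_bounded[OF Omega(2)] q(1), of "v i t"]
          by (intro mult_mono) (auto simp: dist_norm intro: less_imp_le)
        ultimately show "gF (c t) \<bullet> V t $ i \<le> gF (c t) \<bullet> q + \<delta>"
          using r(2) by (simp add: V_def inner_diff_left inner_diff_right)
      qed
    qed
  qed
  have c_flow: "((\<lambda>\<tau>. \<beta> \<tau> *\<^sub>R (average (V \<tau>) - c \<tau>)) has_integral (c b - c a)) {a..b}"
    if "0 \<le> a" "a \<le> b" for a b
    using has_integral_linear[OF X_flow[OF that] bounded_linear_average]
    by (simp add: o_def c_def linear_add[OF linear_average] linear_diff[OF linear_average]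
        linear_cmul[OF linear_average] average_laplacian_flow[OF graph(3)])
  have "((\<lambda>t. F (c t)) \<longlongrightarrow> F q) at_top"
  proof (rule frank_wolfe_optimality[OF Omega(2) F_cont F_below gF_lipschitz beta_pos beta_integrable
        beta_diverges _ c_in _ c_flow exact q])
    show "continuous_on {0..} c"
      unfolding c_def by (intro bounded_linear.continuous_on[OF bounded_linear_average] X_cont)
    show "average (V t) \<in> \<Omega>" if "t \<ge> 0" for t
      using v_in that by (intro average_in_convex Omega(1)) (simp add: V_def)
  qed
  then have dist_opt: "((\<lambda>t. infdist (c t) (optimal_solutions f \<Omega>)) \<longlongrightarrow> 0) at_top"
    unfolding optimal
    by (intro infdist_minimizers_tendsto_0[OF Omega(2) F_cont q(2)] eventually_mono[OF eventually_ge_at_top c_in])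

  \<comment> \<open>The moving optimum approached by all agents is the one closest to their average.\<close>
  define p where "p t = closest_point (optimal_solutions f \<Omega>) (c t)" for t
  have closed_opt: "closed (optimal_solutions f \<Omega>)"
    using continuous_closed_preimage[OF F_cont compact_imp_closed[OF Omega(2)], of "{F q}"]
    unfolding optimal by (simp add: vimage_def Int_def)
  have opt_ne: "optimal_solutions f \<Omega> \<noteq> {}" using q(1) by (auto simp: optimal)
  have p_in: "p t \<in> optimal_solutions f \<Omega>" for t
    unfolding p_def by (rule closest_point_in_set[OF closed_opt opt_ne])
  have c_p: "((\<lambda>t. c t - p t) \<longlongrightarrow> 0) at_top"
  proof (rule Lim_null_comparison[OF always_eventually dist_opt], rule allI)
    fix t
    obtain s where "s \<in> optimal_solutions f \<Omega>" "infdist (c t) (optimal_solutions f \<Omega>) = dist (c t) s"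
      using infdist_attains_inf[OF closed_opt opt_ne] by blast
    then show "norm (c t - p t) \<le> infdist (c t) (optimal_solutions f \<Omega>)"
      using closest_point_le[OF closed_opt] by (simp add: p_def dist_norm)
  qed
  have x_p: "((\<lambda>t. x i t - p t) \<longlongrightarrow> 0) at_top" for i
    using tendsto_add[OF x_c[of i] c_p] by simp

  have "((\<lambda>t. x i t - x j t) \<longlongrightarrow> 0) at_top" for i j
    using tendsto_diff[OF x_c[of i] x_c[of j]] by simp
  moreover have "((\<lambda>t. z i t - (1 / real CARD('v)) *\<^sub>R (\<Sum>j\<in>UNIV. gradient (f j) (x j t))) \<longlongrightarrow> 0) at_top" for i
    using tracking[of i] by (simp add: average_def grads_def)
  moreover have "converge_to_common_optimum f \<Omega> x"
    unfolding converge_to_common_optimum_def using p_in x_p by blast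
  moreover have "(x i \<longlongrightarrow> p0) at_top" if "optimal_solutions f \<Omega> = {p0}" for p0 i
  proof -
    have "p t = p0" for t using p_in[of t] that by simp
    then show ?thesis using LIM_zero_cancel[of "x i" p0] x_p[of i] by simp
  qed
  ultimately show ?thesis by blast
qed

end
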